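(* For the least squares regression problem: (1) any asymptotically exact streaming algorithm for regression working under turnstile updates uses $\Omega(nd)$ memory; (2) any asymptotically exact streaming algorithm for regression working under unique turnstile updates (each coordinate of the input matrix is modified only once) uses $\Omega(nd)$ memory; (3) any asymptotically exact streaming algorithm for regression working under turnstile updates, under the additional assumption that the smallest singular value of the input matrix diverges, uses $\Omega(nd)$ memory.
   Context: Least squares regression: given $A\in\mathbb{R}^{n\times d}$ and $b\in\mathbb{R}^n$, find $\tilde x$ with $\|A\tilde x-b\|\le(1+\varepsilon)\min_{x\in\mathbb{R}^d}\|Ax-b\|$. In the turnstile model, the stream consists of updates, each adding a value to a single entry of $A$ or $b$ (entries start at $0$). An asymptotically exact streaming algorithm for regression is a one-pass algorithm that, on an infinite update stream, after every prefix outputs $\tilde x$ achieving approximation factor $1+\varepsilon$ with $\varepsilon\to0$ as the length of the stream grows, with probability at least $1-\delta$ ($\delta<1/2$). The memory bounds are in bits, in the worst case, for an $n\times d$ input matrix. *)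

theory Defs
  imports
    "HOL-Probability.Probability_Mass_Function"
    "Jordan_Normal_Form.Char_Poly"
begin

type_synonym rmat = "real Matrix.mat"
type_synonym rvec = "real Matrix.vec"

section \<open>Least squares regression\<close>

definition eucl_norm :: "rvec \<Rightarrow> real" where
  "eucl_norm v = sqrt (scalar_prod v v)"

definition reg_cost :: "rmat \<Rightarrow> rvec \<Rightarrow> rvec \<Rightarrow> real" where
  "reg_cost A b x = eucl_norm (A *\<^sub>v x - b)"

definition reg_opt :: "rmat \<Rightarrow> rvec \<Rightarrow> real" where
  "reg_opt A b = (INF x \<in> carrier_vec (dim_col A). reg_cost A b x)"

definition reg_approx :: "real \<Rightarrow> rmat \<Rightarrow> rvec \<Rightarrow> rvec set" where
  "reg_approx \<epsilon> A b =
     {x \<in> carrier_vec (dim_col A). reg_cost A b x \<le> (1 + \<epsilon>) * reg_opt A b}"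

text \<open>An \<open>n \<times> d\<close> matrix has \<open>min n d\<close> singular values (with multiplicity): the square roots of
  the eigenvalues of the smaller of its two Gram matrices.\<close>

definition singular_values :: "rmat \<Rightarrow> real set" where
  "singular_values A = {sqrt k | k. eigenvalue
     (if dim_col A \<le> dim_row A then transpose_mat A * A else A * transpose_mat A) k}"

definition smallest_singular_value :: "rmat \<Rightarrow> real" where
  "smallest_singular_value A = Min (singular_values A)"


section \<open>Update streams\<close>

datatype entry_update = Upd_A nat nat real | Upd_b nat real

fun upd_value :: "entry_update \<Rightarrow> real" where
  "upd_value (Upd_A i j v) = v"
| "upd_value (Upd_b i v) = v"

fun upd_in_range :: "nat \<Rightarrow> nat \<Rightarrow> entry_update \<Rightarrow> bool" where
  "upd_in_range n d (Upd_A i j v) \<longleftrightarrow> i < n \<and> j < d"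
| "upd_in_range n d (Upd_b i v) \<longleftrightarrow> i < n"

fun delta_A :: "entry_update \<Rightarrow> nat \<Rightarrow> nat \<Rightarrow> real" where
  "delta_A (Upd_A i j v) i' j' = (if i = i' \<and> j = j' then v else 0)"
| "delta_A (Upd_b i v) i' j' = 0"

fun delta_b :: "entry_update \<Rightarrow> nat \<Rightarrow> real" where
  "delta_b (Upd_A i j v) i' = 0"
| "delta_b (Upd_b i v) i' = (if i = i' then v else 0)"

type_synonym stream = "nat \<Rightarrow> entry_update"

definition stream_prefix :: "stream \<Rightarrow> nat \<Rightarrow> entry_update list" where
  "stream_prefix \<sigma> t = map \<sigma> [0..<t]"

definition input_A :: "nat \<Rightarrow> nat \<Rightarrow> entry_update list \<Rightarrow> rmat" where
  "input_A n d us = Matrix.mat n d (\<lambda>(i, j). \<Sum>u\<leftarrow>us. delta_A u i j)"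

definition input_b :: "nat \<Rightarrow> entry_update list \<Rightarrow> rvec" where
  "input_b n us = Matrix.vec n (\<lambda>i. \<Sum>u\<leftarrow>us. delta_b u i)"

text \<open>\<open>V\<close> is the set of values that may be added to an entry.\<close>

definition turnstile_streams :: "real set \<Rightarrow> nat \<Rightarrow> nat \<Rightarrow> stream set" where
  "turnstile_streams V n d = {\<sigma>. \<forall>t. upd_in_range n d (\<sigma> t) \<and> upd_value (\<sigma> t) \<in> V}"

text \<open>Uniqueness concerns the coordinates of the input matrix \<open>A\<close>; the right-hand side \<open>b\<close> may be
  updated repeatedly (otherwise an \<open>n \<times> d\<close> instance would admit no infinite stream).\<close>

definition unique_turnstile_streams :: "real set \<Rightarrow> nat \<Rightarrow> nat \<Rightarrow> stream set" where
  "unique_turnstile_streams V n d = {\<sigma> \<in> turnstile_streams V n d.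
     \<forall>s t i j v w. \<sigma> s = Upd_A i j v \<and> \<sigma> t = Upd_A i j w \<longrightarrow> s = t}"

definition diverging_turnstile_streams :: "real set \<Rightarrow> nat \<Rightarrow> nat \<Rightarrow> stream set" where
  "diverging_turnstile_streams V n d = {\<sigma> \<in> turnstile_streams V n d.
     filterlim (\<lambda>t. smallest_singular_value (input_A n d (stream_prefix \<sigma> t))) at_top sequentially}"


section \<open>Streaming algorithms\<close>

text \<open>The whole memory content is a bit string; an update is processed, and an answer is produced,
  from that bit string only, using fresh random bits. Random bits needed later have to be stored.\<close>

record streaming_alg =
  alg_init :: "bool list pmf"
  alg_step :: "entry_update \<Rightarrow> bool list \<Rightarrow> bool list pmf"
  alg_out :: "bool list \<Rightarrow> rvec pmf"

definition run :: "streaming_alg \<Rightarrow> entry_update list \<Rightarrow> bool list pmf" where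
  "run \<A> us = foldl (\<lambda>p u. bind_pmf p (alg_step \<A> u)) (alg_init \<A>) us"

definition answer :: "streaming_alg \<Rightarrow> entry_update list \<Rightarrow> rvec pmf" where
  "answer \<A> us = bind_pmf (run \<A> us) (alg_out \<A>)"

text \<open>The rate \<open>\<epsilon>\<close> may depend on the stream.\<close>

definition asymptotically_exact ::
  "real \<Rightarrow> nat \<Rightarrow> nat \<Rightarrow> stream set \<Rightarrow> streaming_alg \<Rightarrow> bool" where
  "asymptotically_exact \<delta> n d S \<A> \<longleftrightarrow>
     (\<forall>\<sigma>\<in>S. \<exists>\<epsilon>. (\<forall>t. 0 \<le> \<epsilon> t) \<and> \<epsilon> \<longlonglongrightarrow> 0 \<and>
        (\<forall>t. let us = stream_prefix \<sigma> t in
           measure_pmf.prob (answer \<A> us) (reg_approx (\<epsilon> t) (input_A n d us) (input_b n us))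
             \<ge> 1 - \<delta>))"

definition worst_case_memory :: "streaming_alg \<Rightarrow> entry_update list set \<Rightarrow> ereal" where
  "worst_case_memory \<A> P =
     (SUP us \<in> P. SUP s \<in> set_pmf (run \<A> us). ereal (real (length s)))"

definition prefixes_of :: "stream set \<Rightarrow> entry_update list set" where
  "prefixes_of S = {stream_prefix \<sigma> t | \<sigma> t. \<sigma> \<in> S}"

definition small_prefixes_of :: "nat \<Rightarrow> stream set \<Rightarrow> entry_update list set" where
  "small_prefixes_of T S =
     {us \<in> prefixes_of S. length us \<le> T \<and> (\<forall>u \<in> set us. \<bar>upd_value u\<bar> \<le> 1)}"

text \<open>\<open>\<Omega>(nd)\<close> memory for the model \<open>\<S>\<close>, with a constant independent of \<open>n\<close>, \<open>d\<close>, the set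
  \<open>V\<close> of update values and the algorithm. Real updates are the case \<open>V = UNIV\<close>, integer updates
  the case \<open>V = \<int>\<close>. Since \<open>V\<close> is unbounded, the plain worst case over all
  prefixes also counts memory spent on storing large numbers; the second conjunct excludes that
  effect by demanding the bound already for at most \<open>n * d\<close> updates of absolute value at most 1.
  It is confined to \<open>d \<le> n\<close>: for \<open>n = 1\<close> a single nonzero entry of \<open>A\<close> determines an
  optimal solution.\<close>

definition needs_Omega_nd_memory ::
  "real \<Rightarrow> (real set \<Rightarrow> nat \<Rightarrow> nat \<Rightarrow> stream set) \<Rightarrow> bool" where
  "needs_Omega_nd_memory \<delta> \<S> \<longleftrightarrow>
     (\<exists>c>0. \<forall>V n d \<A>. \<int> \<subseteq> V \<and> 1 \<le> n \<and> 1 \<le> d \<and> asymptotically_exact \<delta> n d (\<S> V n d) \<A> \<longrightarrow>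
        ereal (c * real n * real d) \<le> worst_case_memory \<A> (prefixes_of (\<S> V n d)) \<and>
        (d \<le> n \<longrightarrow> ereal (c * real n * real d) \<le>
           worst_case_memory \<A> (small_prefixes_of (n * d) (\<S> V n d))))"

end

theory Submission
  imports Defs "Jordan_Normal_Form.Spectral_Radius"
begin

text \<open>All three bounds are reductions from the one-way communication problem INDEX: Alice encodes
  signs \<open>s\<^sub>k\<^sub>c\<close> in the entries of \<open>A\<close>, the memory content is her message, and Bob continues the
  stream so that a nearly optimal solution reveals the sign he asks for. INDEX on \<open>m\<close> bits with error
  \<open>\<delta> < 1 / 2\<close> needs \<open>\<Omega>(m)\<close> bits. There are finitely many inputs of Alice, so Bob can wait until \<open>\<epsilon>\<close> is
  below any fixed threshold for all of them; the normal equations then hold up to a small error.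

  For unique updates Bob writes \<open>N\<close> times an identity matrix below the block of signs and queries
  \<open>b = e\<^sub>i\<close>, whence \<open>x\<^sub>j \<approx> s\<^sub>i\<^sub>j / N\<^sup>2\<close>. If the smallest singular value has to diverge,
  \<open>N\<close> must grow along the stream, and the threshold on \<open>\<epsilon>\<close> may not depend on it. Bob then
  adds \<open>N\<close> to one entry of every column, among them entry \<open>(i, j)\<close>, and sets
  \<open>b = N e\<^sub>i\<close>; now \<open>N (1 - x\<^sub>j) \<approx> s\<^sub>i\<^sub>j\<close>, and a wrong sign changes the cost by a constant factor.

  The bound over all prefixes, for arbitrary \<open>n\<close> and \<open>d\<close>, is cheaper: with \<open>A\<^sub>0\<^sub>0 = a\<close> as the only nonzero
  entry and \<open>b = e\<^sub>0\<close> the system is consistent, so that \<open>x\<^sub>0 = 1 / a\<close> exactly.\<close>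

unbundle no vec_syntax

section \<open>The INDEX lower bound for streaming algorithms\<close>

text \<open>Bob's half of the protocol: \<open>s\<close> is the message he receives,
  \<open>us\<close> his continuation of the stream.\<close>

definition answer_from :: "streaming_alg \<Rightarrow> bool list \<Rightarrow> entry_update list \<Rightarrow> rvec pmf" where
  "answer_from \<A> s us =
     bind_pmf (foldl (\<lambda>p u. bind_pmf p (alg_step \<A> u)) (return_pmf s) us) (alg_out \<A>)"

lemma foldl_bind_pmf:
  "foldl (\<lambda>p u. bind_pmf p (f u)) p us
     = bind_pmf p (\<lambda>s. foldl (\<lambda>p u. bind_pmf p (f u)) (return_pmf s) us)"
proof (induction us arbitrary: p)
  case (Cons u us)
  have "foldl (\<lambda>p u. bind_pmf p (f u)) p (u # us)
      = bind_pmf (bind_pmf p (f u)) (\<lambda>s. foldl (\<lambda>p u. bind_pmf p (f u)) (return_pmf s) us)"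
    using Cons.IH[of "bind_pmf p (f u)"] by simp
  also have "\<dots> = bind_pmf p (\<lambda>s. bind_pmf (f u s)
      (\<lambda>s. foldl (\<lambda>p u. bind_pmf p (f u)) (return_pmf s) us))"
    by (simp add: bind_assoc_pmf)
  also have "\<dots> = bind_pmf p (\<lambda>s. foldl (\<lambda>p u. bind_pmf p (f u)) (f u s) us)"
    by (intro bind_pmf_cong refl Cons.IH[symmetric])
  finally show ?case by (simp add: bind_return_pmf)
qed (simp add: bind_return_pmf')

lemma answer_append:
  "answer \<A> (us @ vs) = bind_pmf (run \<A> us) (\<lambda>s. answer_from \<A> s vs)"
  unfolding answer_def answer_from_def run_def foldl_append
  by (subst foldl_bind_pmf) (simp add: bind_assoc_pmf)

lemma prob_bind_pmf:
  "measure_pmf.prob (bind_pmf p f) X = measure_pmf.expectation p (\<lambda>s. measure_pmf.prob (f s) X)"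
  unfolding measure_pmf_bind
  by (subst measure_pmf.measure_bind[where N = "count_space UNIV"])
     (auto simp: measure_pmf_in_subprob_algebra space_subprob_algebra
       intro!: measure_pmf.subprob_space_axioms)

text \<open>This replaces Alice's random message by one fixed memory content; the uniform bound
  makes \<open>f\<close> integrable.\<close>

lemma expectation_attained:
  fixes f :: "'a \<Rightarrow> real"
  assumes "\<And>s. \<bar>f s\<bar> \<le> B" and "c \<le> measure_pmf.expectation p f"
  shows "\<exists>s\<in>set_pmf p. c \<le> f s"
proof (rule ccontr)
  assume "\<not> ?thesis"
  then have lt: "\<And>s. s \<in> set_pmf p \<Longrightarrow> f s < c" by force
  have int: "integrable (measure_pmf p) f"
    by (rule measure_pmf.integrable_const_bound[where B = B]) (use assms(1) in auto)
  have "measure_pmf.expectation p f < measure_pmf.expectation p (\<lambda>_. c)"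
  proof (rule measure_pmf.integral_less_AE_space)
    show "AE x in measure_pmf p. f x < c"
      using lt by (simp add: AE_measure_pmf_iff)
  qed (use int in auto)
  with assms(2) show False by simp
qed

text \<open>A weak form of cosh y \<le> exp (y^2 / 2): exp z \<le> 1 + z + z^2 and exp (-z) \<le> 1
  - z + z^2 sum to at most 2 + 2 z^2. By symmetry z \<ge> 0 suffices.\<close>

lemma exp_add_exp_minus_le:
  fixes y :: real
  assumes "\<bar>y\<bar> \<le> 1"
  shows "exp y + exp (- y) \<le> 2 * exp (y\<^sup>2)"
proof -
  have pos: "exp z + exp (- z) \<le> 2 * exp (z\<^sup>2)" if "0 \<le> z" "z \<le> 1" for z :: real
  proof -
    have 1: "exp z \<le> 1 + z + z\<^sup>2" using that exp_bound by auto
    \<comment> \<open>The product equals \<open>1 + z ^ 3\<close>.\<close>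
    have "1 \<le> (1 + z) * (1 - z + z\<^sup>2)" using that
      by (simp add: algebra_simps power2_eq_square)
    also have "\<dots> \<le> exp z * (1 - z + z\<^sup>2)"
    proof (rule mult_right_mono)
      have "0 \<le> (1 - z) + z\<^sup>2" using that by (intro add_nonneg_nonneg) auto
      then show "0 \<le> 1 - z + z\<^sup>2" by simp
    qed (use exp_ge_add_one_self in auto)
    finally have 2: "exp (- z) \<le> 1 - z + z\<^sup>2"
      by (simp add: exp_minus field_simps)
    show ?thesis using 1 2 exp_ge_add_one_self[of "z\<^sup>2"] by linarith
  qed
  show ?thesis
    using pos[of y] pos[of "- y"] assms by (cases "0 \<le> y") auto
qed

text \<open>Chernoff bound for a uniformly random \<open>x \<subseteq> I\<close>: whatever the probabilities \<open>q\<close>, the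
  expected fraction of correctly decoded bits is \<open>1 / 2\<close>.\<close>

lemma card_well_decoded_le:
  fixes q :: "'i \<Rightarrow> real" and \<gamma> :: real
  assumes I: "finite I" and q: "\<And>i. i \<in> I \<Longrightarrow> 0 \<le> q i \<and> q i \<le> 1" and \<gamma>: "0 \<le> \<gamma>" "\<gamma> \<le> 1 / 2"
  shows "real (card {x \<in> Pow I. (1 / 2 + \<gamma>) * card I \<le> (\<Sum>i\<in>I. if i \<in> x then q i else 1 - q i)})
           \<le> 2 ^ card I * exp (- (\<gamma>\<^sup>2 * card I))" (is "real (card ?X) \<le> _")
proof -
  \<comment> \<open>Exponential Markov inequality: \<open>w x\<close> is the exponential of
    \<open>2 * \<gamma>\<close> times the excess of the sum over its threshold, hence at least 1 on
    the counted sets. \<open>f\<close> is the factor of a bit in \<open>x\<close>, \<open>g\<close>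
    that of a bit outside.\<close>
  define f where "f i = exp (2 * \<gamma> * (q i - 1 / 2 - \<gamma>))" for i
  define g where "g i = exp (2 * \<gamma> * (1 / 2 - q i - \<gamma>))" for i
  define w where "w x = (\<Prod>i\<in>x. f i) * (\<Prod>i\<in>I - x. g i)" for x
  have w_ge: "1 \<le> w x" if "x \<in> ?X" for x
  proof -
    from that have x: "x \<subseteq> I" by simp
    have "w x = (\<Prod>i\<in>I. if i \<in> x then f i else g i)"
      unfolding w_def using x I
      by (simp add: prod.If_cases Int_absorb1 Diff_eq)
    also have "\<dots> = (\<Prod>i\<in>I. exp (2 * \<gamma> * ((if i \<in> x then q i else 1 - q i) - (1 / 2 + \<gamma>))))"
      by (intro prod.cong) (auto simp: f_def g_def algebra_simps)
    also have "\<dots> = exp (2 * \<gamma> * ((\<Sum>i\<in>I. if i \<in> x then q i else 1 - q i) - (1 / 2 + \<gamma>) * card I))"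
      using I by (simp add: exp_sum[symmetric] sum_distrib_left[symmetric] sum_subtractf mult.commute)
    finally show ?thesis using that \<gamma> by simp
  qed
  have fg: "f i + g i \<le> 2 * exp (- (\<gamma>\<^sup>2))" if "i \<in> I" for i
  proof -
    \<comment> \<open>The exponents in \<open>f i\<close> and \<open>g i\<close> are
      \<open>y - 2 * \<gamma>\<^sup>2\<close> and \<open>- y - 2 * \<gamma>\<^sup>2\<close>.\<close>
    define y where "y = 2 * \<gamma> * (q i - 1 / 2)"
    have qi: "\<bar>q i - 1 / 2\<bar> \<le> 1 / 2" using q[OF that] by linarith
    have y: "\<bar>y\<bar> \<le> \<gamma>"
      using mult_left_mono[OF qi, of "2 * \<gamma>"] \<gamma> by (simp add: y_def abs_mult)
    have "f i + g i = exp (- (2 * \<gamma>\<^sup>2)) * (exp y + exp (- y))"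
      unfolding f_def g_def y_def
      by (simp add: distrib_left flip: exp_add) (simp add: algebra_simps power2_eq_square)
    also have "\<dots> \<le> exp (- (2 * \<gamma>\<^sup>2)) * (2 * exp (y\<^sup>2))"
      using exp_add_exp_minus_le[of y] y \<gamma> by (intro mult_left_mono) auto
    also have "\<dots> \<le> exp (- (2 * \<gamma>\<^sup>2)) * (2 * exp (\<gamma>\<^sup>2))"
      using y \<gamma> by (intro mult_left_mono) (auto simp: abs_le_square_iff[symmetric])
    also have "\<dots> = 2 * exp (- (\<gamma>\<^sup>2))"
      by (simp flip: exp_add)
    finally show ?thesis .
  qed
  have "real (card ?X) = (\<Sum>x\<in>?X. 1)" by simp
  also have "\<dots> \<le> (\<Sum>x\<in>?X. w x)" by (intro sum_mono w_ge)
  also have "\<dots> \<le> (\<Sum>x\<in>Pow I. w x)"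
    using I by (intro sum_mono2) (auto simp: w_def f_def g_def intro!: mult_nonneg_nonneg prod_nonneg)
  \<comment> \<open>Expanding the product of the \<open>f i + g i\<close> yields one summand
    \<open>w x\<close> per subset, so the bits decouple.\<close>
  also have "\<dots> = (\<Prod>i\<in>I. f i + g i)"
    unfolding w_def using I by (simp add: prod_add)
  also have "\<dots> \<le> (\<Prod>i\<in>I. 2 * exp (- (\<gamma>\<^sup>2)))"
    by (intro prod_mono conjI fg) (auto simp: f_def g_def intro: add_nonneg_nonneg)
  also have "\<dots> = 2 ^ card I * exp (- (\<gamma>\<^sup>2 * card I))"
    by (simp add: power_mult_distrib exp_of_nat_mult[symmetric] mult.commute)
  finally show ?thesis .
qed

text \<open>By averaging over the memory contents, every \<open>x\<close> has a single reachable memory content from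
  which the expected number of correctly decoded bits is at least \<open>(1 - \<delta>) * card I\<close>; each memory
  content serves only few \<open>x\<close>.\<close>

lemma index_bound:
  fixes enc :: "'i set \<Rightarrow> entry_update list" and dec :: "'i \<Rightarrow> rvec set"
  assumes I: "finite I" "I \<noteq> {}" and \<delta>: "0 \<le> \<delta>" "\<delta> < 1 / 2"
    and dec: "\<And>x i. x \<subseteq> I \<Longrightarrow> i \<in> I \<Longrightarrow>
      1 - \<delta> \<le> measure_pmf.prob (answer \<A> (enc x @ suf i)) (if i \<in> x then dec i else - dec i)"
    and len: "\<And>x s. x \<subseteq> I \<Longrightarrow> s \<in> set_pmf (run \<A> (enc x)) \<Longrightarrow> length s \<le> L"
  shows "(1 / 2 - \<delta>)\<^sup>2 / 2 * card I \<le> L"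
proof -
  define \<gamma> where "\<gamma> = 1 / 2 - \<delta>"
  have \<gamma>: "0 < \<gamma>" "\<gamma> \<le> 1 / 2" using \<delta> by (auto simp: \<gamma>_def)
  define m where "m = card I"
  have m: "0 < m" using I by (simp add: m_def card_gt_0_iff)
  define q where "q s i = measure_pmf.prob (answer_from \<A> s (suf i)) (dec i)" for s i
  define M where "M = {s :: bool list. length s \<le> L}"
  define X where "X s = {x \<in> Pow I. (1 / 2 + \<gamma>) * card I
      \<le> (\<Sum>i\<in>I. if i \<in> x then q s i else 1 - q s i)}" for s
  have M: "finite M" "card M = (\<Sum>i\<le>L. 2 ^ i)"
    using card_lists_length_le[of "UNIV :: bool set" L] finite_lists_length_le[of "UNIV :: bool set" L]
    by (auto simp: M_def)
  have q01: "0 \<le> q s i \<and> q s i \<le> 1" for s i by (simp add: q_def)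
  have ex: "\<exists>s\<in>M. x \<in> X s" if x: "x \<subseteq> I" for x
  proof -
    define c where "c s i = measure_pmf.prob (answer_from \<A> s (suf i)) (if i \<in> x then dec i else - dec i)"
      for s i
    have c: "c s i = (if i \<in> x then q s i else 1 - q s i)" for s i
      by (auto simp: c_def q_def measure_pmf.prob_compl[where A = "dec i", simplified, symmetric] Compl_eq_Diff_UNIV)
    have int: "integrable (measure_pmf (run \<A> (enc x))) (\<lambda>s. c s i)" for i
      by (rule measure_pmf.integrable_const_bound[where B = 1]) (auto simp: c_def)
    have "(1 / 2 + \<gamma>) * card I = (\<Sum>i\<in>I. 1 - \<delta>)" by (simp add: \<gamma>_def)
    also have "\<dots> \<le> (\<Sum>i\<in>I. measure_pmf.expectation (run \<A> (enc x)) (\<lambda>s. c s i))"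
      using dec[OF x] by (intro sum_mono) (simp add: c_def answer_append prob_bind_pmf)
    also have "\<dots> = measure_pmf.expectation (run \<A> (enc x)) (\<lambda>s. \<Sum>i\<in>I. c s i)"
      using int by (simp add: Bochner_Integration.integral_sum)
    finally have "\<exists>s\<in>set_pmf (run \<A> (enc x)). (1 / 2 + \<gamma>) * card I \<le> (\<Sum>i\<in>I. c s i)"
    proof (rule expectation_attained[rotated])
      fix s
      have "\<bar>\<Sum>i\<in>I. c s i\<bar> \<le> (\<Sum>i\<in>I. \<bar>c s i\<bar>)" by (rule sum_abs)
      also have "\<dots> \<le> (\<Sum>i\<in>I. 1)" by (intro sum_mono) (simp add: c_def)
      finally show "\<bar>\<Sum>i\<in>I. c s i\<bar> \<le> real m" by (simp add: m_def)
    qed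
    then show ?thesis using x len[OF x] by (auto simp: X_def M_def c)
  qed
  \<comment> \<open>Union bound over the memory contents: the sets \<open>X s\<close> cover all
    \<open>2 ^ m\<close> subsets, and each is small by the Chernoff bound.\<close>
  have "2 ^ m = real (card (Pow I))" using I by (simp add: card_Pow m_def)
  also have "\<dots> \<le> real (card (\<Union>s\<in>M. X s))"
    using ex M(1) I by (intro of_nat_mono card_mono) (auto simp: X_def)
  also have "\<dots> \<le> (\<Sum>s\<in>M. real (card (X s)))"
    using card_UN_le[OF M(1), of X] by (metis of_nat_mono of_nat_sum)
  also have "\<dots> \<le> (\<Sum>s\<in>M. 2 ^ m * exp (- (\<gamma>\<^sup>2 * m)))"
    unfolding X_def m_def using I q01 \<gamma> by (intro sum_mono card_well_decoded_le) auto
  also have "\<dots> = 2 ^ m * (real (card M) * exp (- (\<gamma>\<^sup>2 * m)))"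
    by simp
  finally have "1 \<le> real (card M) * exp (- (\<gamma>\<^sup>2 * m))"
    by simp
  then have card_ge: "exp (\<gamma>\<^sup>2 * m) \<le> real (card M)"
    by (simp add: exp_minus field_simps)
  \<comment> \<open>There are fewer than \<open>2 ^ (L + 1)\<close> contents; for
    \<open>L \<noteq> 0\<close> this is at most \<open>2 ^ (2 * L)\<close>, which absorbs the
    additive constant. With \<open>L = 0\<close> only the empty content would remain, too few since
    \<gamma> and \<open>m\<close> are positive.\<close>
  have "L \<noteq> 0"
  proof
    assume "L = 0"
    then have "exp (\<gamma>\<^sup>2 * m) \<le> 1" using card_ge M by simp
    moreover have "0 < \<gamma>\<^sup>2 * m" using \<gamma> m by simp
    ultimately show False by simp
  qed
  have "card M \<le> 2 ^ (L + 1)"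
    unfolding M(2) lessThan_Suc_atMost[symmetric] using sum_power2[of "Suc L"]
    by (simp add: lessThan_atLeast0)
  also have "\<dots> \<le> 2 ^ (2 * L)"
    using \<open>L \<noteq> 0\<close> by (intro power_increasing) auto
  finally have "real (card M) \<le> 2 ^ (2 * L)"
    by (metis of_nat_mono of_nat_numeral of_nat_power)
  also have "\<dots> \<le> exp 1 ^ (2 * L)"
    using exp_ge_add_one_self[of 1] by (intro power_mono) auto
  also have "\<dots> = exp (2 * real L)" by (simp flip: exp_of_nat_mult)
  finally have "exp (\<gamma>\<^sup>2 * m) \<le> exp (2 * real L)" using card_ge by linarith
  then show ?thesis by (simp add: \<gamma>_def m_def)
qed

text \<open>Passes from a length bound to the supremum: memory below \<open>B\<close> would bound
  all lengths by the largest integer \<open>L < B\<close>, whereas \<open>index_bound\<close> gives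
  \<open>B \<le> L\<close>.\<close>

lemma index_memory:
  fixes enc :: "'i set \<Rightarrow> entry_update list" and dec :: "'i \<Rightarrow> rvec set"
  assumes I: "finite I" "I \<noteq> {}" and \<delta>: "0 \<le> \<delta>" "\<delta> < 1 / 2"
    and dec: "\<And>x i. x \<subseteq> I \<Longrightarrow> i \<in> I \<Longrightarrow>
      1 - \<delta> \<le> measure_pmf.prob (answer \<A> (enc x @ suf i)) (if i \<in> x then dec i else - dec i)"
    and P: "\<And>x. x \<subseteq> I \<Longrightarrow> enc x \<in> P"
  shows "ereal ((1 / 2 - \<delta>)\<^sup>2 / 2 * card I) \<le> worst_case_memory \<A> P"
proof (rule ccontr)
  define B where "B = (1 / 2 - \<delta>)\<^sup>2 / 2 * card I"
  have B: "0 < B" using I \<delta> by (simp add: B_def card_gt_0_iff)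
  assume "\<not> ?thesis"
  then have less: "worst_case_memory \<A> P < ereal B" by (simp add: B_def)
  define L where "L = nat (\<lceil>B\<rceil> - 1)"
  have L: "real L < B" using B by (simp add: L_def) linarith
  have "B \<le> L"
    unfolding B_def
  proof (rule index_bound[OF I \<delta> dec])
    fix x s
    assume x: "x \<subseteq> I" and s: "s \<in> set_pmf (run \<A> (enc x))"
    have "ereal (real (length s)) \<le> worst_case_memory \<A> P"
      unfolding worst_case_memory_def
      by (rule SUP_upper2[OF P[OF x]], rule SUP_upper2[OF s]) simp
    then have "real (length s) < B" using less by (metis ereal_less(2) less_ereal.simps(1) order.strict_trans1)
    then show "length s \<le> L" unfolding L_def by linarith
  qed
  with L show False by simp
qed

section \<open>Approximately optimal solutions\<close>

definition residual :: "rmat \<Rightarrow> rvec \<Rightarrow> rvec \<Rightarrow> nat \<Rightarrow> real" where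
  "residual A b z k = (\<Sum>c<dim_col A. A $$ (k, c) * z $ c) - b $ k"

lemma reg_cost_nonneg: "0 \<le> reg_cost A b z"
  by (simp add: reg_cost_def eucl_norm_def scalar_prod_def sum_nonneg)

lemma reg_cost_power2:
  assumes "A \<in> carrier_mat n d" "b \<in> carrier_vec n" "z \<in> carrier_vec d"
  shows "(reg_cost A b z)\<^sup>2 = (\<Sum>k<n. (residual A b z k)\<^sup>2)"
proof -
  have "(reg_cost A b z)\<^sup>2 = scalar_prod (A *\<^sub>v z - b) (A *\<^sub>v z - b)"
    by (simp add: reg_cost_def eucl_norm_def scalar_prod_def sum_nonneg)
  also have "\<dots> = (\<Sum>k<n. (residual A b z k)\<^sup>2)"
    using assms
    by (auto simp: scalar_prod_def residual_def power2_eq_square lessThan_atLeast0 intro!: sum.cong)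
  finally show ?thesis .
qed

lemma residual_le_reg_cost:
  assumes "A \<in> carrier_mat n d" "b \<in> carrier_vec n" "z \<in> carrier_vec d" "k < n"
  shows "\<bar>residual A b z k\<bar> \<le> reg_cost A b z"
proof -
  have "(residual A b z k)\<^sup>2 \<le> (\<Sum>k<n. (residual A b z k)\<^sup>2)"
    using assms(4) by (intro member_le_sum) auto
  then show ?thesis
    using reg_cost_power2[OF assms(1-3)] reg_cost_nonneg[of A b z]
    by (metis abs_le_square_iff abs_of_nonneg)
qed

lemma reg_opt_le: "z \<in> carrier_vec (dim_col A) \<Longrightarrow> reg_opt A b \<le> reg_cost A b z"
  unfolding reg_opt_def by (rule cINF_lower) (auto intro!: bdd_belowI[of _ 0] simp: reg_cost_nonneg)

lemma reg_opt_nonneg: "0 \<le> reg_opt A b"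
  unfolding reg_opt_def
  by (rule cINF_greatest) (metis empty_iff zero_carrier_vec, rule reg_cost_nonneg)

lemma reg_approx_mono: "\<epsilon> \<le> \<epsilon>' \<Longrightarrow> reg_approx \<epsilon> A b \<subseteq> reg_approx \<epsilon>' A b"
  unfolding reg_approx_def using reg_opt_nonneg[of A b]
  by (auto elim!: order_trans intro: mult_right_mono)

lemma reg_approx_cost_le:
  assumes "z \<in> reg_approx \<epsilon> A b" "0 \<le> \<epsilon>" "y \<in> carrier_vec (dim_col A)"
  shows "reg_cost A b z \<le> (1 + \<epsilon>) * reg_cost A b y"
  using assms reg_opt_le[OF assms(3), of b]
  by (auto simp: reg_approx_def elim!: order_trans intro!: mult_left_mono)

text \<open>Moving \<open>z\<close> by \<open>h\<close> along the \<open>j\<close>-th axis changes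
  the squared cost to R + 2 h g + h^2 G, with minimum R - g^2 / G at h = - g / G. Near-optimality
  forbids a large gain, and (1 + \<epsilon>)^2 \<le> 1 + 3 \<epsilon> turns this into g^2 / G \<le>
  3 \<epsilon> R. For \<epsilon> = 0 it is the exact normal equation.\<close>

lemma reg_approx_normal_equation:
  assumes A: "A \<in> carrier_mat n d" and b: "b \<in> carrier_vec n"
    and z: "z \<in> reg_approx \<epsilon> A b" and \<epsilon>: "0 \<le> \<epsilon>" "\<epsilon> \<le> 1" and j: "j < d"
  shows "(\<Sum>k<n. A $$ (k, j) * residual A b z k)\<^sup>2
           \<le> 3 * \<epsilon> * (reg_cost A b z)\<^sup>2 * (\<Sum>k<n. (A $$ (k, j))\<^sup>2)"
proof -
  define g where "g = (\<Sum>k<n. A $$ (k, j) * residual A b z k)"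
  define G where "G = (\<Sum>k<n. (A $$ (k, j))\<^sup>2)"
  define R where "R = (reg_cost A b z)\<^sup>2"
  have zc: "z \<in> carrier_vec d" using z A by (simp add: reg_approx_def)
  have G0: "0 \<le> G" by (simp add: G_def sum_nonneg)
  have step: "R \<le> (1 + 3 * \<epsilon>) * (R + 2 * h * g + h\<^sup>2 * G)" for h
  proof -
    define y where "y = z + h \<cdot>\<^sub>v unit_vec d j"
    have y: "y \<in> carrier_vec d" using zc by (simp add: y_def)
    have res: "residual A b y k = residual A b z k + h * A $$ (k, j)" for k
    proof -
      have "(\<Sum>c<d. A $$ (k, c) * y $ c)
          = (\<Sum>c<d. A $$ (k, c) * z $ c + (if c = j then h * A $$ (k, j) else 0))"
        using zc by (intro sum.cong) (auto simp: y_def unit_vec_def algebra_simps)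
      then show ?thesis using A j by (simp add: residual_def sum.distrib)
    qed
    have "(reg_cost A b y)\<^sup>2 = (\<Sum>k<n. (residual A b z k)\<^sup>2
        + 2 * h * (A $$ (k, j) * residual A b z k) + h\<^sup>2 * (A $$ (k, j))\<^sup>2)"
      unfolding reg_cost_power2[OF A b y] res
      by (intro sum.cong) (auto simp: algebra_simps power2_eq_square)
    also have "\<dots> = R + 2 * h * g + h\<^sup>2 * G"
      by (simp add: sum.distrib R_def reg_cost_power2[OF A b zc] g_def G_def sum_distrib_left)
    finally have cy: "(reg_cost A b y)\<^sup>2 = R + 2 * h * g + h\<^sup>2 * G" .
    have "R \<le> ((1 + \<epsilon>) * reg_cost A b y)\<^sup>2"
      unfolding R_def using reg_approx_cost_le[OF z \<epsilon>(1), of y] y A reg_cost_nonneg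
      by (intro power_mono) auto
    also have "\<dots> = (1 + \<epsilon>)\<^sup>2 * (reg_cost A b y)\<^sup>2" by (simp add: power_mult_distrib)
    also have "\<dots> \<le> (1 + 3 * \<epsilon>) * (reg_cost A b y)\<^sup>2"
      using \<epsilon> mult_left_mono[of \<epsilon> 1 \<epsilon>] by (intro mult_right_mono) (auto simp: power2_eq_square algebra_simps)
    finally show ?thesis by (simp add: cy)
  qed
  show ?thesis
  proof (cases "G = 0")
    case True
    then have "\<And>k. k < n \<Longrightarrow> A $$ (k, j) = 0"
      by (simp add: G_def sum_nonneg_eq_0_iff)
    then show ?thesis by simp
  next
    case False
    with G0 have G: "0 < G" by simp
    have "R + 2 * (- (g / G)) * g + (- (g / G))\<^sup>2 * G = R - g\<^sup>2 / G"
      using G by (simp add: field_simps power2_eq_square)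
    with step[of "- (g / G)"] have "R \<le> (1 + 3 * \<epsilon>) * (R - g\<^sup>2 / G)" by metis
    then have "(1 + 3 * \<epsilon>) * (g\<^sup>2 / G) \<le> 3 * \<epsilon> * R" by (simp add: algebra_simps)
    moreover have "1 * (g\<^sup>2 / G) \<le> (1 + 3 * \<epsilon>) * (g\<^sup>2 / G)"
      using \<epsilon> G by (intro mult_right_mono) auto
    ultimately have "g\<^sup>2 / G \<le> 3 * \<epsilon> * R" by linarith
    then show ?thesis using G by (simp add: g_def G_def R_def divide_le_eq)
  qed
qed

text \<open>A solvable system has optimum 0, and a multiplicative error leaves 0 at 0, whatever
  \<epsilon> is.\<close>

lemma reg_approx_consistent:
  assumes A: "A \<in> carrier_mat n d" and b: "b \<in> carrier_vec n"
    and y: "y \<in> carrier_vec d" "\<And>k. k < n \<Longrightarrow> residual A b y k = 0"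
    and z: "z \<in> reg_approx \<epsilon> A b" and k: "k < n"
  shows "residual A b z k = 0"
proof -
  have "(reg_cost A b y)\<^sup>2 = 0" using y by (simp add: reg_cost_power2[OF A b])
  then have "reg_opt A b = 0"
    using reg_opt_le[of y A b] reg_opt_nonneg[of A b] y A by auto
  then have "reg_cost A b z = 0" and zc: "z \<in> carrier_vec d"
    using z A reg_cost_nonneg[of A b z] by (auto simp: reg_approx_def)
  then show ?thesis using residual_le_reg_cost[OF A b zc k] by simp
qed

section \<open>Reading one sign off a nearly optimal solution\<close>

lemma sum_lessThan_if:
  fixes f :: "nat \<Rightarrow> real"
  assumes "m \<le> n"
  shows "(\<Sum>c<n. if c < m then f c else 0) = (\<Sum>c<m. f c)"
  using assms by (intro sum.mono_neutral_cong_right) auto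

text \<open>With \<open>b = e\<^sub>i\<close> and large \<open>N\<close>, the solution of the normal equations is about \<open>N\<^sup>-\<^sup>2\<close> times
  the \<open>i\<close>-th row of the block \<open>s\<close>.\<close>

lemma block_query_sign:
  fixes s :: "nat \<Rightarrow> nat \<Rightarrow> real"
  assumes A: "A \<in> carrier_mat n d" and b: "b \<in> carrier_vec n"
    and dims: "n' + d' \<le> n" "d' \<le> d" and i: "i < n'" and j: "j < d'"
    and A_entry: "\<And>k c. k < n \<Longrightarrow> c < d \<Longrightarrow> A $$ (k, c) =
      (if k < n' \<and> c < d' then s k c else if c < d' \<and> k = n' + c then N else 0)"
    and b_entry: "\<And>k. k < n \<Longrightarrow> b $ k = (if k = i then 1 else 0)"
    and s: "\<And>k c. \<bar>s k c\<bar> = 1"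
    and N: "8 * real n * real d \<le> N"
    and z: "z \<in> reg_approx \<epsilon> A b" and \<epsilon>: "0 \<le> \<epsilon>" "200 * (n + N\<^sup>2) * \<epsilon> \<le> 1"
  shows "0 < s i j * z $ j"
proof -
  define r where "r = residual A b z"
  have zc: "z \<in> carrier_vec d" using z A by (simp add: reg_approx_def)
  have nd: "1 \<le> real n" "1 \<le> real d" using dims i j by auto
  then have "1 \<le> real n * real d" by (metis mult_mono' mult_1 zero_le_one)
  with N have N8: "8 \<le> N" by linarith
  have \<epsilon>1: "\<epsilon> \<le> 1"
  proof -
    have "1 * \<epsilon> \<le> 200 * (n + N\<^sup>2) * \<epsilon>"
    proof (rule mult_right_mono)
      show "1 \<le> 200 * (n + N\<^sup>2)" using nd zero_le_power2[of N] by argo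
    qed (fact \<epsilon>)
    with \<epsilon> show ?thesis by linarith
  qed
  \<comment> \<open>The competitor 0 leaves the residual \<open>- b\<close>, of norm 1, so
    \<open>z\<close> costs at most 2.\<close>
  have "(reg_cost A b (0\<^sub>v d))\<^sup>2 = (\<Sum>k<n. if k = i then 1 else 0)"
    unfolding reg_cost_power2[OF A b zero_carrier_vec]
    using A b_entry by (intro sum.cong) (auto simp: residual_def)
  also have "\<dots> = 1" using dims i by simp
  finally have "reg_cost A b (0\<^sub>v d) = 1" using reg_cost_nonneg[of A b "0\<^sub>v d"]
    by (simp add: power2_eq_1_iff)
  then have cost: "reg_cost A b z \<le> 2"
    using reg_approx_cost_le[OF z \<epsilon>(1), of "0\<^sub>v d"] A \<epsilon>1 by simp
  have r_le: "\<bar>r k\<bar> \<le> 2" if "k < n" for k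
    using residual_le_reg_cost[OF A b zc that] cost by (simp add: r_def)
  \<comment> \<open>The rows of the scaled identity have right-hand side 0, so bounded residuals
    force the coordinates of \<open>z\<close> to be at most \<open>2 / N\<close> in absolute
    value.\<close>
  have r_bot: "r (n' + c) = N * z $ c" if "c < d'" for c
  proof -
    have "(\<Sum>c'<d. A $$ (n' + c, c') * z $ c') = (\<Sum>c'<d. if c' = c then N * z $ c else 0)"
      using dims that by (intro sum.cong) (auto simp: A_entry)
    then show ?thesis using A dims that i by (simp add: r_def residual_def b_entry)
  qed
  have z_le: "\<bar>z $ c\<bar> \<le> 2 / N" if "c < d'" for c
  proof -
    have "\<bar>N * z $ c\<bar> \<le> 2" using r_le[of "n' + c"] r_bot[OF that] dims that by simp
    then show ?thesis using N8 by (simp add: abs_mult field_simps)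
  qed
  define p where "p k = (\<Sum>c<d'. s k c * z $ c)" for k
  have r_top: "r k = p k - (if k = i then 1 else 0)" if "k < n'" for k
  proof -
    have "(\<Sum>c<d. A $$ (k, c) * z $ c) = (\<Sum>c<d. if c < d' then s k c * z $ c else 0)"
      using dims that by (intro sum.cong) (auto simp: A_entry)
    also have "\<dots> = p k"
      unfolding p_def by (rule sum_lessThan_if[OF dims(2)])
    finally show ?thesis using A dims that by (simp add: r_def residual_def b_entry)
  qed
  have p_le: "\<bar>p k\<bar> \<le> d * (2 / N)" for k
  proof -
    have "\<bar>p k\<bar> \<le> (\<Sum>c<d'. \<bar>s k c * z $ c\<bar>)" unfolding p_def by (rule sum_abs)
    also have "\<dots> \<le> (\<Sum>c<d'. 2 / N)" by (intro sum_mono) (simp add: abs_mult s z_le)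
    also have "\<dots> \<le> d * (2 / N)" using dims N8 by (simp add: divide_right_mono)
    finally show ?thesis .
  qed
  \<comment> \<open>In the \<open>j\<close>-th normal equation the sign block contributes
    \<open>q - s i j\<close> and the identity block \<open>N\<^sup>2 * z $ j\<close>; with
    \<open>g\<close> and \<open>q\<close> small, the latter has to balance
    \<open>s i j\<close>.\<close>
  define g where "g = (\<Sum>k<n. A $$ (k, j) * r k)"
  define q where "q = (\<Sum>k<n'. s k j * p k)"
  have "g = (\<Sum>k<n. (if k < n' then s k j * r k else 0) + (if k = n' + j then N * r (n' + j) else 0))"
    unfolding g_def using dims j by (intro sum.cong) (auto simp: A_entry)
  also have "\<dots> = (\<Sum>k<n. if k < n' then s k j * r k else 0) + N * r (n' + j)"
    using dims j by (simp add: sum.distrib)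
  also have "(\<Sum>k<n. if k < n' then s k j * r k else 0) = (\<Sum>k<n'. s k j * r k)"
    using dims by (intro sum_lessThan_if) simp
  also have "\<dots> = (\<Sum>k<n'. s k j * p k - (if k = i then s i j else 0))"
    by (intro sum.cong) (auto simp: r_top algebra_simps)
  also have "\<dots> = q - s i j" using i by (simp add: q_def sum_subtractf)
  finally have g_eq: "g = q - s i j + N\<^sup>2 * z $ j"
    using r_bot[OF j] by (simp add: power2_eq_square)
  \<comment> \<open>\<open>q\<close> is at most \<open>n * d * (2 / N)\<close> in absolute value,
    hence the factor 8 in the bound on \<open>N\<close>.\<close>
  have q_le: "\<bar>q\<bar> \<le> 1 / 4"
  proof -
    have "\<bar>q\<bar> \<le> (\<Sum>k<n'. \<bar>s k j * p k\<bar>)" unfolding q_def by (rule sum_abs)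
    also have "\<dots> \<le> (\<Sum>k<n'. d * (2 / N))" by (intro sum_mono) (use p_le in \<open>simp add: abs_mult s\<close>)
    also have "\<dots> = n' * (d * (2 / N))" by simp
    also have "\<dots> \<le> n * (d * (2 / N))" using dims N8 by (intro mult_right_mono) auto
    also have "\<dots> \<le> 1 / 4" using N N8 by (simp add: field_simps)
    finally show ?thesis .
  qed
  have G_le: "(\<Sum>k<n. (A $$ (k, j))\<^sup>2) \<le> n + N\<^sup>2"
  proof -
    have s2: "(s k c)\<^sup>2 = 1" for k c using s[of k c] by (metis abs_1 power2_eq_1_iff power2_abs power_one)
    have "(\<Sum>k<n. (A $$ (k, j))\<^sup>2) \<le> (\<Sum>k<n. 1 + (if k = n' + j then N\<^sup>2 else 0))"
      using dims j by (intro sum_mono) (auto simp: A_entry s2)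
    also have "\<dots> = n + N\<^sup>2" using dims j by (simp add: sum.distrib)
    finally show ?thesis .
  qed
  have "g\<^sup>2 \<le> 3 * \<epsilon> * (reg_cost A b z)\<^sup>2 * (\<Sum>k<n. (A $$ (k, j))\<^sup>2)"
    unfolding g_def r_def by (rule reg_approx_normal_equation[OF A b z \<epsilon>(1) \<epsilon>1]) (use dims j in simp)
  \<comment> \<open>Here the factor 200 enters: \<open>12 / 200 \<le> 1 / 16\<close>.\<close>
  also have "\<dots> \<le> 3 * \<epsilon> * 2\<^sup>2 * (n + N\<^sup>2)"
    using cost reg_cost_nonneg \<epsilon> G_le by (intro mult_mono power_mono) (auto intro: sum_nonneg)
  also have "\<dots> \<le> (1 / 4)\<^sup>2" using \<epsilon> by (simp add: power2_eq_square algebra_simps)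
  finally have "\<bar>g\<bar> \<le> 1 / 4"
    by (metis abs_le_square_iff abs_of_nonneg zero_le_divide_1_iff zero_le_numeral)
  with g_eq q_le have near: "\<bar>N\<^sup>2 * z $ j - s i j\<bar> \<le> 1 / 2" by linarith
  consider "s i j = 1" | "s i j = - 1" using s[of i j] by linarith
  then show ?thesis
  proof cases
    case 1
    with near have "0 < N\<^sup>2 * z $ j" by linarith
    with 1 show ?thesis by (simp add: zero_less_mult_iff)
  next
    case 2
    with near have "N\<^sup>2 * z $ j < 0" by linarith
    with 2 show ?thesis by (simp add: mult_less_0_iff)
  qed
qed

text \<open>Here the residual of row \<open>\<pi> j\<close> nearly vanishes, so that \<open>N * (1 - z\<^sub>j)\<close> is close to the
  entry of \<open>s\<close> in that row. In contrast to \<open>block_query_sign\<close>, the admissible \<open>\<epsilon>\<close> does not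
  depend on \<open>N\<close>.\<close>

lemma permutation_query_sign:
  fixes s :: "nat \<Rightarrow> nat \<Rightarrow> real"
  assumes A: "A \<in> carrier_mat n d" and b: "b \<in> carrier_vec n"
    and \<pi>: "inj_on \<pi> {..<d}" "\<And>c. c < d \<Longrightarrow> \<pi> c < n" and j: "j < d"
    and A_entry: "\<And>k c. k < n \<Longrightarrow> c < d \<Longrightarrow> A $$ (k, c) = s k c + (if k = \<pi> c then N else 0)"
    and b_entry: "\<And>k. k < n \<Longrightarrow> b $ k = (if k = \<pi> j then N else 0)"
    and s: "\<And>k c. k < n \<Longrightarrow> c < d \<Longrightarrow> \<bar>s k c\<bar> = 1"
    and N: "16 * real n ^ 2 + 13 * real n * real d \<le> N"
    and z: "z \<in> reg_approx \<epsilon> A b" and \<epsilon>: "0 \<le> \<epsilon>" "3072 * real n ^ 3 * \<epsilon> \<le> 1"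
  shows "0 < s (\<pi> j) j * (1 - z $ j)"
proof -
  define r where "r = residual A b z"
  define i where "i = \<pi> j"
  \<comment> \<open>\<open>u\<close> is the deviation of \<open>z\<close> from the
    \<open>j\<close>-th unit vector, the natural competitor: column \<open>j\<close> of
    \<open>A\<close> differs from \<open>b\<close> by signs only. \<open>U\<close> is the sum norm
    of \<open>u\<close>.\<close>
  define u where "u c = z $ c - (if c = j then 1 else 0)" for c
  define U where "U = (\<Sum>c<d. \<bar>u c\<bar>)"
  have zc: "z \<in> carrier_vec d" using z A by (simp add: reg_approx_def)
  have i: "i < n" using \<pi>(2)[OF j] by (simp add: i_def)
  have nd: "1 \<le> real n" "1 \<le> real d" using i j by auto
  have nd1: "1 \<le> real n * real d" using nd by (metis mult_mono' mult_1 zero_le_one)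
  have N1: "1 \<le> N" using N nd1 zero_le_power2[of "real n"] by argo
  have \<epsilon>1: "\<epsilon> \<le> 1"
  proof -
    have "1 * \<epsilon> \<le> 3072 * real n ^ 3 * \<epsilon>"
      using one_le_power[OF nd(1), of 3] \<epsilon> by (intro mult_right_mono) auto
    with \<epsilon> show ?thesis by linarith
  qed
  have "(reg_cost A b (unit_vec d j))\<^sup>2 = (\<Sum>k<n. 1)"
    unfolding reg_cost_power2[OF A b unit_vec_carrier]
  proof (rule sum.cong)
    fix k assume "k \<in> {..<n}"
    then have k: "k < n" by simp
    have "(\<Sum>c<d. A $$ (k, c) * unit_vec d j $ c) = (\<Sum>c<d. if c = j then A $$ (k, j) else 0)"
      using j by (intro sum.cong) (auto simp: unit_vec_def)
    then have "residual A b (unit_vec d j) k = s k j"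
      using A j k by (simp add: residual_def A_entry b_entry)
    then show "(residual A b (unit_vec d j) k)\<^sup>2 = 1"
      using s[OF k j] by (metis abs_1 power2_abs power_one)
  qed simp
  also have "\<dots> \<le> (real n)\<^sup>2" using nd by (simp add: power2_eq_square)
  finally have "reg_cost A b (unit_vec d j) \<le> n"
    by (rule power2_le_imp_le) simp
  then have "(1 + \<epsilon>) * reg_cost A b (unit_vec d j) \<le> 2 * real n"
    using \<epsilon>1 \<epsilon> reg_cost_nonneg by (intro mult_mono) auto
  with reg_approx_cost_le[OF z \<epsilon>(1), of "unit_vec d j"] A
  have cost: "reg_cost A b z \<le> 2 * real n" by simp
  have r_le: "\<bar>r k\<bar> \<le> 2 * real n" if "k < n" for k
    using residual_le_reg_cost[OF A b zc that] cost by (simp add: r_def)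
  have r_eq: "r (\<pi> c) = s (\<pi> c) j + (\<Sum>c'<d. s (\<pi> c) c' * u c') + N * u c" if c: "c < d" for c
  proof -
    define f where "f c' = s (\<pi> c) c' * u c'" for c'
    have "(\<Sum>c'<d. A $$ (\<pi> c, c') * z $ c') = (\<Sum>c'<d. f c'
        + (if c' = j then s (\<pi> c) j else 0) + (if c' = c then N * z $ c else 0))"
    proof (rule sum.cong)
      fix c' assume "c' \<in> {..<d}"
      then have "\<pi> c = \<pi> c' \<longleftrightarrow> c' = c" using \<pi>(1) c by (auto dest: inj_onD)
      then show "A $$ (\<pi> c, c') * z $ c' = f c'
          + (if c' = j then s (\<pi> c) j else 0) + (if c' = c then N * z $ c else 0)"
        using \<pi>(2)[OF c] \<open>c' \<in> {..<d}\<close> by (simp add: A_entry f_def u_def algebra_simps)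
    qed simp
    also have "\<dots> = (\<Sum>c'<d. f c') + s (\<pi> c) j + N * z $ c"
      using c j by (simp add: sum.distrib)
    finally have "(\<Sum>c'<d. A $$ (\<pi> c, c') * z $ c') = (\<Sum>c'<d. f c') + s (\<pi> c) j + N * z $ c" .
    moreover have "b $ \<pi> c = N * (if c = j then 1 else 0)"
      using \<pi> c j by (auto simp: b_entry dest: inj_onD)
    ultimately show ?thesis
      using A by (simp add: r_def residual_def f_def u_def[of c] right_diff_distrib)
  qed
  have su_le: "\<bar>\<Sum>c'<d. s k c' * u c'\<bar> \<le> U" if "k < n" for k
  proof -
    have "\<bar>\<Sum>c'<d. s k c' * u c'\<bar> \<le> (\<Sum>c'<d. \<bar>s k c' * u c'\<bar>)" by (rule sum_abs)
    also have "\<dots> = U" unfolding U_def using that by (intro sum.cong) (auto simp: abs_mult s)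
    finally show ?thesis .
  qed
  \<comment> \<open>Summing the equations of the rows \<open>\<pi> c\<close> gives N U \<le> d (2 n
    + 1) + d U; since N \<ge> d + 4 d (2 n + 1), this yields U \<le> 1 / 4. The term 13 n d in the
    bound on \<open>N\<close> covers 5 d + 8 n d.\<close>
  have U_le: "U \<le> 1 / 4"
  proof -
    have "N * \<bar>u c\<bar> \<le> 2 * real n + 1 + U" if c: "c < d" for c
    proof -
      have "N * \<bar>u c\<bar> = \<bar>N * u c\<bar>" using N1 by (simp add: abs_mult)
      also have "\<dots> \<le> 2 * real n + 1 + U"
        using r_eq[OF c] r_le[OF \<pi>(2)[OF c]] su_le[OF \<pi>(2)[OF c]] s[OF \<pi>(2)[OF c] j] by linarith
      finally show ?thesis .
    qed
    then have "(\<Sum>c<d. N * \<bar>u c\<bar>) \<le> (\<Sum>c<d. 2 * real n + 1 + U)" by (intro sum_mono) auto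
    then have NU: "N * U \<le> d * (2 * real n + 1) + d * U"
      by (simp add: U_def sum_distrib_left algebra_simps)
    have "real d \<le> real n * real d" using nd by (simp add: mult_le_cancel_right1)
    then have "5 * real d + 8 * (real n * real d) \<le> N"
      using N zero_le_power2[of "real n"] by linarith
    then have "d + 4 * (d * (2 * real n + 1)) \<le> N" by (simp add: algebra_simps)
    moreover have U0: "0 \<le> U" by (simp add: U_def sum_nonneg)
    ultimately have "(d + 4 * (d * (2 * real n + 1))) * U \<le> N * U" by (intro mult_right_mono)
    with NU have "(d * (2 * real n + 1)) * (4 * U) \<le> (d * (2 * real n + 1)) * 1"
      by (simp add: algebra_simps)
    moreover have "0 < d * (2 * real n + 1)" using nd by (intro mult_pos_pos) auto
    ultimately have "4 * U \<le> 1" by (metis mult_le_cancel_left_pos)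
    then show ?thesis by simp
  qed
  define g where "g = (\<Sum>k<n. A $$ (k, j) * r k)"
  have "g = (\<Sum>k<n. s k j * r k + (if k = i then N * r i else 0))"
    unfolding g_def using j by (intro sum.cong) (auto simp: A_entry i_def algebra_simps)
  then have g_eq: "g = (\<Sum>k<n. s k j * r k) + N * r i"
    using i by (simp add: sum.distrib)
  have q_le: "\<bar>\<Sum>k<n. s k j * r k\<bar> \<le> 2 * (real n)\<^sup>2"
  proof -
    have "\<bar>\<Sum>k<n. s k j * r k\<bar> \<le> (\<Sum>k<n. \<bar>s k j * r k\<bar>)" by (rule sum_abs)
    also have "\<dots> \<le> (\<Sum>k<n. 2 * real n)"
      using r_le j by (intro sum_mono) (auto simp: abs_mult s)
    finally show ?thesis by (simp add: power2_eq_square)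
  qed
  have G_le: "(\<Sum>k<n. (A $$ (k, j))\<^sup>2) \<le> n * (N + 1)\<^sup>2"
  proof -
    have "(\<Sum>k<n. (A $$ (k, j))\<^sup>2) \<le> (\<Sum>k<n. (N + 1)\<^sup>2)"
    proof (rule sum_mono)
      fix k assume "k \<in> {..<n}"
      then have "\<bar>A $$ (k, j)\<bar> \<le> \<bar>N + 1\<bar>"
        using s[of k j] j N1 by (auto simp: A_entry)
      then show "(A $$ (k, j))\<^sup>2 \<le> (N + 1)\<^sup>2" by (simp only: abs_le_square_iff)
    qed
    then show ?thesis by simp
  qed
  have "g\<^sup>2 \<le> 3 * \<epsilon> * (reg_cost A b z)\<^sup>2 * (\<Sum>k<n. (A $$ (k, j))\<^sup>2)"
    unfolding g_def r_def by (rule reg_approx_normal_equation[OF A b z \<epsilon>(1) \<epsilon>1 j])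
  also have "\<dots> \<le> 3 * \<epsilon> * (2 * real n)\<^sup>2 * (n * (N + 1)\<^sup>2)"
    using cost reg_cost_nonneg \<epsilon> G_le by (intro mult_mono power_mono) (auto intro: sum_nonneg)
  \<comment> \<open>\<open>3072 = 12 * 16\<^sup>2\<close>. The bound on \<open>g\<close> is
    proportional to \<open>N + 1\<close> and \<open>g\<close> contains \<open>N * r i\<close>, so
    dividing by \<open>N\<close> leaves a condition on \<epsilon> that is free of
    \<open>N\<close>.\<close>
  also have "\<dots> = (3072 * real n ^ 3 * \<epsilon>) * ((N + 1) / 16)\<^sup>2"
    by (simp add: power2_eq_square power3_eq_cube)
  also have "\<dots> \<le> 1 * ((N + 1) / 16)\<^sup>2"
    using \<epsilon> by (intro mult_right_mono) auto
  finally have "\<bar>g\<bar> \<le> \<bar>(N + 1) / 16\<bar>"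
    by (simp only: abs_le_square_iff mult_1_left)
  moreover have "16 * (real n)\<^sup>2 \<le> N" using N nd1 by linarith
  \<comment> \<open>The two parts are \<open>(N + 1) / 16 \<le> N / 8\<close> and
    \<open>2 * (real n)\<^sup>2 \<le> N / 8\<close>.\<close>
  ultimately have "\<bar>N * r i\<bar> \<le> N / 4" using g_eq q_le N1 by argo
  then have r_i: "\<bar>r i\<bar> \<le> 1 / 4" using N1 by (simp add: abs_mult)
  have "\<bar>N * u j + s i j\<bar> \<le> 1 / 2"
    using r_eq[OF j, folded i_def] su_le[OF i] U_le r_i by linarith
  then have near: "\<bar>N * (z $ j - 1) + s i j\<bar> \<le> 1 / 2" by (simp add: u_def)
  have Npos: "0 < N" using N1 by simp
  consider "s i j = 1" | "s i j = - 1" using s[OF i j] by linarith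
  then show ?thesis
  proof cases
    case 1
    with near have "N * (z $ j - 1) < 0" by linarith
    with 1 Npos show ?thesis by (simp add: mult_less_0_iff i_def)
  next
    case 2
    with near have "0 < N * (z $ j - 1)" by linarith
    with 2 Npos show ?thesis by (simp add: zero_less_mult_iff i_def)
  qed
qed

section \<open>Lower bounds for the smallest singular value\<close>

text \<open>A complex eigenvalue exists. The form v^* M v, called \<open>S\<close> below, is that
  eigenvalue times the squared norm of the eigenvector and equals its own conjugate; hence the
  eigenvalue is real and a root of the real characteristic polynomial.\<close>

lemma real_symmetric_eigenvalue:
  fixes M :: rmat
  assumes M: "M \<in> carrier_mat k k" and k: "0 < k" and sym: "transpose_mat M = M"
  shows "\<exists>e. eigenvalue M e"
proof -
  define C where "C = map_mat complex_of_real M"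
  have C: "C \<in> carrier_mat k k" using M by (simp add: C_def)
  obtain \<mu> where ev: "eigenvalue C \<mu>"
    using spectrum_non_empty[OF C k] by (auto simp: spectrum_def)
  then obtain v where v: "v \<in> carrier_vec k" "v \<noteq> 0\<^sub>v k" "C *\<^sub>v v = \<mu> \<cdot>\<^sub>v v"
    using C by (auto simp: eigenvalue_def eigenvector_def)
  have symE: "M $$ (a, b) = M $$ (b, a)" if "a < k" "b < k" for a b
    using that M sym by (metis carrier_matD index_transpose_mat(1))
  define S where "S = (\<Sum>a<k. \<Sum>b<k. complex_of_real (M $$ (a, b)) * v $ b * cnj (v $ a))"
  define q where "q = (\<Sum>a<k. (cmod (v $ a))\<^sup>2)"
  have row: "(\<Sum>b<k. complex_of_real (M $$ (a, b)) * v $ b) = \<mu> * v $ a" if "a < k" for a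
  proof -
    have "(C *\<^sub>v v) $ a = (\<Sum>b<k. complex_of_real (M $$ (a, b)) * v $ b)"
      using that C v(1) M by (auto simp: C_def scalar_prod_def lessThan_atLeast0 intro!: sum.cong)
    then show ?thesis using v that by simp
  qed
  have "S = (\<Sum>a<k. \<mu> * v $ a * cnj (v $ a))"
    unfolding S_def by (intro sum.cong) (auto simp: row[symmetric] sum_distrib_right)
  then have S: "S = \<mu> * complex_of_real q"
    by (simp add: q_def sum_distrib_left mult.assoc complex_norm_square[symmetric] flip: of_real_power)
  have "cnj S = (\<Sum>a<k. \<Sum>b<k. complex_of_real (M $$ (a, b)) * cnj (v $ b) * v $ a)"
    by (simp add: S_def)
  also have "\<dots> = (\<Sum>b<k. \<Sum>a<k. complex_of_real (M $$ (a, b)) * cnj (v $ b) * v $ a)"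
    by (rule sum.swap)
  also have "\<dots> = S"
    unfolding S_def by (intro sum.cong) (auto simp: symE)
  finally have "cnj S = S" .
  have "q \<noteq> 0"
  proof
    assume "q = 0"
    then have "\<And>a. a < k \<Longrightarrow> v $ a = 0" by (auto simp: q_def sum_nonneg_eq_0_iff)
    then have "v = 0\<^sub>v k" using v(1) by auto
    with v show False by simp
  qed
  then have "cnj \<mu> = \<mu>" using \<open>cnj S = S\<close> S by simp
  then obtain e where e: "\<mu> = complex_of_real e"
    by (metis Reals_cnj_iff Reals_cases)
  have "poly (char_poly C) \<mu> = 0" using ev eigenvalue_root_char_poly[OF C] by simp
  moreover have "char_poly C = map_poly complex_of_real (char_poly M)"
    unfolding C_def by (rule of_real_hom.char_poly_hom[OF M])
  ultimately have "poly (char_poly M) e = 0" by (simp add: e)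
  then show ?thesis using eigenvalue_root_char_poly[OF M] by auto
qed

text \<open>For an eigenvector \<open>v\<close>, |M v|^2 is \<open>e\<close> times |v|^2; the
  hypothesis \<open>ge\<close> compares the two.\<close>

lemma gram_eigenvalue_ge:
  fixes M :: rmat
  assumes M: "M \<in> carrier_mat p k" and e: "eigenvalue (transpose_mat M * M) e"
    and ge: "\<And>v. v \<in> carrier_vec k \<Longrightarrow> K * scalar_prod v v \<le> scalar_prod (M *\<^sub>v v) (M *\<^sub>v v)"
  shows "K \<le> e"
proof -
  obtain v where v: "v \<in> carrier_vec k" "v \<noteq> 0\<^sub>v k" "(transpose_mat M * M) *\<^sub>v v = e \<cdot>\<^sub>v v"
    using e M by (auto simp: eigenvalue_def eigenvector_def)
  have "scalar_prod (M *\<^sub>v v) (M *\<^sub>v v) = scalar_prod (transpose_mat M *\<^sub>v (M *\<^sub>v v)) v"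
    using M v by (intro transpose_vec_mult_scalar[symmetric]) auto
  also have "transpose_mat M *\<^sub>v (M *\<^sub>v v) = e \<cdot>\<^sub>v v"
    using M v by (simp flip: v(3))
  finally have "K * scalar_prod v v \<le> e * scalar_prod v v"
    using ge[OF v(1)] v(1) by simp
  moreover have "0 < scalar_prod v v"
  proof -
    obtain a where a: "a < k" "v $ a \<noteq> 0" using v by (metis eq_vecI carrier_vecD index_zero_vec)
    then have "0 < (v $ a)\<^sup>2" by simp
    also have "\<dots> \<le> (\<Sum>c<k. (v $ c)\<^sup>2)" using a by (intro member_le_sum) auto
    finally show ?thesis using v(1) by (simp add: scalar_prod_def lessThan_atLeast0 power2_eq_square)
  qed
  ultimately show ?thesis by simp
qed

text \<open>\<open>M\<close> is the orientation of \<open>A\<close> with at least as many rows as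
  columns, the one whose Gram matrix defines \<open>singular_values\<close>.\<close>

lemma smallest_singular_value_ge:
  fixes A :: rmat
  assumes A: "A \<in> carrier_mat n d" "0 < n" "0 < d"
    and M: "M = (if d \<le> n then A else transpose_mat A)"
    and \<kappa>: "0 \<le> \<kappa>"
    and ge: "\<And>v. v \<in> carrier_vec (min n d) \<Longrightarrow>
      \<kappa>\<^sup>2 * scalar_prod v v \<le> scalar_prod (M *\<^sub>v v) (M *\<^sub>v v)"
  shows "\<kappa> \<le> smallest_singular_value A"
proof -
  have Mc: "M \<in> carrier_mat (max n d) (min n d)" using A M by (auto simp: max_def min_def)
  define G where "G = transpose_mat M * M"
  have G: "G \<in> carrier_mat (min n d) (min n d)" using Mc by (simp add: G_def)
  have sv: "singular_values A = sqrt ` spectrum G"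
    using A M by (auto simp: singular_values_def G_def spectrum_def)
  have "transpose_mat G = G" using Mc by (simp add: G_def transpose_mult[OF _ Mc])
  \<comment> \<open>\<open>Min\<close> of an empty set would be unspecified, so an eigenvalue must
    exist.\<close>
  then have "spectrum G \<noteq> {}"
    using real_symmetric_eigenvalue[OF G] A by (auto simp: spectrum_def)
  moreover have "finite (spectrum G)" using card_finite_spectrum[OF G] by simp
  moreover have "\<kappa> \<le> sqrt e" if "e \<in> spectrum G" for e
    using gram_eigenvalue_ge[OF Mc _ ge, of e] that \<kappa>
    by (auto simp: spectrum_def G_def intro: real_le_rsqrt)
  ultimately show ?thesis
    unfolding smallest_singular_value_def sv by (subst Min_ge_iff) auto
qed

text \<open>Let V be the largest |v_c|. Row \<open>\<rho> c\<close> of M v is at least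
  \<open>w\<close> V minus a contribution of at most \<open>C * k\<close> V from the other
  coordinates, while |v|^2 is at most \<open>k\<close> V^2.\<close>

lemma dominant_rows_gram_ge:
  fixes M :: rmat
  assumes M: "M \<in> carrier_mat p k" and k: "0 < k"
    and \<rho>: "\<And>c. c < k \<Longrightarrow> \<rho> c < p"
    and big: "\<And>c. c < k \<Longrightarrow> w \<le> M $$ (\<rho> c, c)"
    and small: "\<And>c c'. c < k \<Longrightarrow> c' < k \<Longrightarrow> c' \<noteq> c \<Longrightarrow> \<bar>M $$ (\<rho> c, c')\<bar> \<le> C"
    and C: "0 \<le> C" "C * k \<le> w"
    and v: "v \<in> carrier_vec k"
  shows "((w - C * k) / k)\<^sup>2 * scalar_prod v v \<le> scalar_prod (M *\<^sub>v v) (M *\<^sub>v v)"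
proof -
  define V where "V = Max ((\<lambda>c. \<bar>v $ c\<bar>) ` {..<k})"
  have "V \<in> (\<lambda>c. \<bar>v $ c\<bar>) ` {..<k}" unfolding V_def using k by (intro Max_in) auto
  then obtain c where c: "c < k" "V = \<bar>v $ c\<bar>" by auto
  have V: "\<bar>v $ c'\<bar> \<le> V" if "c' < k" for c'
    unfolding V_def using that by (intro Max_ge) auto
  have V0: "0 \<le> V" using c by simp
  have "scalar_prod v v = (\<Sum>c<k. (v $ c)\<^sup>2)"
    using v by (simp add: scalar_prod_def lessThan_atLeast0 power2_eq_square)
  also have "\<dots> \<le> (\<Sum>c<k. V\<^sup>2)"
    using V V0 by (intro sum_mono) (simp add: abs_le_square_iff[symmetric])
  finally have vv: "scalar_prod v v \<le> k * V\<^sup>2" by simp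
  define y where "y = (M *\<^sub>v v) $ \<rho> c"
  define R where "R = (\<Sum>c'\<in>{..<k} - {c}. M $$ (\<rho> c, c') * v $ c')"
  have "y = (\<Sum>c'<k. M $$ (\<rho> c, c') * v $ c')"
    using M v \<rho>[OF c(1)] by (auto simp: y_def scalar_prod_def lessThan_atLeast0 intro!: sum.cong)
  then have y: "y = M $$ (\<rho> c, c) * v $ c + R"
    using c(1) by (simp add: sum.remove[of "{..<k}" c] R_def)
  have "\<bar>R\<bar> \<le> (\<Sum>c'\<in>{..<k} - {c}. \<bar>M $$ (\<rho> c, c') * v $ c'\<bar>)" unfolding R_def by (rule sum_abs)
  also have "\<dots> \<le> (\<Sum>c'\<in>{..<k} - {c}. C * V)"
    unfolding abs_mult using c(1) small V C by (intro sum_mono mult_mono) auto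
  also have "\<dots> \<le> (\<Sum>c'<k. C * V)" using C V0 by (intro sum_mono2) auto
  finally have R: "\<bar>R\<bar> \<le> C * k * V" by (simp add: mult_ac)
  have "0 \<le> w" using C by (metis mult_nonneg_nonneg of_nat_0_le_iff order_trans)
  have "w * V \<le> \<bar>M $$ (\<rho> c, c) * v $ c\<bar>"
    using big[OF c(1)] V0 c(2) \<open>0 \<le> w\<close> by (simp add: abs_mult mult_right_mono)
  with y R have "(w - C * k) * V \<le> \<bar>y\<bar>" by (simp add: algebra_simps)
  then have "((w - C * k) * V)\<^sup>2 \<le> y\<^sup>2"
    using C V0 by (metis abs_le_square_iff abs_of_nonneg diff_ge_0_iff_ge mult_nonneg_nonneg)
  also have "\<dots> \<le> (\<Sum>a<p. ((M *\<^sub>v v) $ a)\<^sup>2)"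
    unfolding y_def using \<rho>[OF c(1)] by (intro member_le_sum) auto
  also have "\<dots> = scalar_prod (M *\<^sub>v v) (M *\<^sub>v v)"
    using M by (simp add: scalar_prod_def lessThan_atLeast0 power2_eq_square)
  finally have up: "((w - C * k) * V)\<^sup>2 \<le> scalar_prod (M *\<^sub>v v) (M *\<^sub>v v)" .
  \<comment> \<open>Division by the root of \<open>k\<close> would be sharp here; division by
    \<open>k\<close> avoids roots.\<close>
  have "((w - C * k) / k)\<^sup>2 * scalar_prod v v \<le> ((w - C * k) / k)\<^sup>2 * (k * V\<^sup>2)"
    using vv by (intro mult_left_mono) auto
  also have "\<dots> = ((w - C * k) * V)\<^sup>2 / k"
    using k by (simp add: power2_eq_square)
  also have "\<dots> \<le> ((w - C * k) * V)\<^sup>2"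
    using k by (simp add: divide_le_eq mult_le_cancel_left1)
  finally show ?thesis using up by linarith
qed

section \<open>Streams\<close>

definition stream_append :: "entry_update list \<Rightarrow> stream \<Rightarrow> stream" where
  "stream_append us \<tau> t = (if t < length us then us ! t else \<tau> (t - length us))"

lemma stream_prefix_append:
  "stream_prefix (stream_append us \<tau>) (length us + t) = us @ stream_prefix \<tau> t"
  by (rule nth_equalityI) (auto simp: stream_prefix_def stream_append_def nth_append)

lemma stream_append_in_prefixes_of:
  assumes "stream_append us \<tau> \<in> S"
  shows "us \<in> prefixes_of S"
proof -
  have "us = stream_prefix (stream_append us \<tau>) (length us)"
    using stream_prefix_append[of us \<tau> 0] by (simp add: stream_prefix_def)
  then show ?thesis using assms unfolding prefixes_of_def by blast
qed

lemma append_in_prefixes_of: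
  assumes "us @ vs \<in> prefixes_of S"
  shows "us \<in> prefixes_of S"
proof -
  obtain \<sigma> t where \<sigma>: "\<sigma> \<in> S" "us @ vs = stream_prefix \<sigma> t"
    using assms by (auto simp: prefixes_of_def)
  have "length us \<le> t" using \<sigma>(2) by (metis length_append length_map length_upt diff_zero
    le_add1 stream_prefix_def)
  moreover have "us = take (length us) (stream_prefix \<sigma> t)" by (simp flip: \<sigma>(2))
  ultimately have "us = stream_prefix \<sigma> (length us)"
    by (simp add: stream_prefix_def take_map)
  then show ?thesis using \<sigma>(1) unfolding prefixes_of_def by blast
qed

lemma stream_append_turnstile:
  assumes "\<And>u. u \<in> set us \<Longrightarrow> upd_in_range n d u \<and> upd_value u \<in> V"
    and "\<tau> \<in> turnstile_streams V n d"
  shows "stream_append us \<tau> \<in> turnstile_streams V n d"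
  using assms by (auto simp: turnstile_streams_def stream_append_def)

lemma input_A_carrier [simp]: "input_A n d us \<in> carrier_mat n d"
  by (simp add: input_A_def)

lemma input_b_carrier [simp]: "input_b n us \<in> carrier_vec n"
  by (simp add: input_b_def)

lemma input_A_append:
  "k < n \<Longrightarrow> c < d \<Longrightarrow>
     input_A n d (us @ vs) $$ (k, c) = input_A n d us $$ (k, c) + input_A n d vs $$ (k, c)"
  by (simp add: input_A_def)

lemma input_b_append:
  "k < n \<Longrightarrow> input_b n (us @ vs) $ k = input_b n us $ k + input_b n vs $ k"
  by (simp add: input_b_def)

lemma input_A_prefix:
  "k < n \<Longrightarrow> c < d \<Longrightarrow> input_A n d (stream_prefix \<tau> t) $$ (k, c) = (\<Sum>s<t. delta_A (\<tau> s) k c)"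
  by (simp add: input_A_def stream_prefix_def comp_def interv_sum_list_conv_sum_set_nat lessThan_atLeast0)

lemma input_b_prefix:
  "k < n \<Longrightarrow> input_b n (stream_prefix \<tau> t) $ k = (\<Sum>s<t. delta_b (\<tau> s) k)"
  by (simp add: input_b_def stream_prefix_def comp_def interv_sum_list_conv_sum_set_nat lessThan_atLeast0)

section \<open>Alice's block of signs\<close>

definition bit_sign :: "nat set \<Rightarrow> nat \<Rightarrow> real" where
  "bit_sign x t = (if t \<in> x then 1 else - 1)"

text \<open>Row-major enumeration of the sign block; \<open>d\<close> is the width of the block,
  which may be less than that of the matrix.\<close>

definition bit_update :: "nat \<Rightarrow> nat set \<Rightarrow> stream" where
  "bit_update d x t = Upd_A (t div d) (t mod d) (bit_sign x t)"

lemma abs_bit_sign [simp]: "\<bar>bit_sign x t\<bar> = 1"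
  by (simp add: bit_sign_def)

lemma div_mod_less:
  fixes t :: nat
  assumes "t < n * d"
  shows "t div d < n" "t mod d < d"
  using assms by (auto simp: less_mult_imp_div_less intro!: mod_less_divisor gr0I)

lemma bit_updates_small:
  assumes "n' \<le> n" "d' \<le> d" "\<int> \<subseteq> V" "u \<in> set (stream_prefix (bit_update d' x) (n' * d'))"
  shows "upd_in_range n d u" "upd_value u \<in> V" "\<bar>upd_value u\<bar> \<le> 1"
proof -
  obtain t where t: "t < n' * d'" and u: "u = bit_update d' x t"
    using assms(4) by (auto simp: stream_prefix_def)
  show "upd_in_range n d u" "\<bar>upd_value u\<bar> \<le> 1"
    using div_mod_less[OF t] assms by (auto simp: u bit_update_def)
  have "bit_sign x t \<in> \<int>" by (simp add: bit_sign_def)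
  then show "upd_value u \<in> V" using assms by (auto simp: u bit_update_def)
qed

lemma bit_updates_small_prefix:
  assumes "stream_append (stream_prefix (bit_update d' x) (n' * d')) \<tau> \<in> S"
    and "n' \<le> n" "d' \<le> d"
  shows "stream_prefix (bit_update d' x) (n' * d') \<in> small_prefixes_of (n * d) S"
  unfolding small_prefixes_of_def
  using stream_append_in_prefixes_of[OF assms(1)] bit_updates_small(3)[OF assms(2,3), of UNIV] assms(2,3)
  by (auto simp: stream_prefix_def intro: mult_le_mono)

lemma input_A_bit_updates:
  assumes "k < n" "c < d" "0 < d'"
  shows "input_A n d (stream_prefix (bit_update d' x) (n' * d')) $$ (k, c) =
    (if k < n' \<and> c < d' then bit_sign x (k * d' + c) else 0)"
proof -
  have "(\<Sum>s<n' * d'. delta_A (bit_update d' x s) k c)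
      = (\<Sum>s<n' * d'. if s = k * d' + c then (if c < d' then bit_sign x (k * d' + c) else 0) else 0)"
  proof (rule sum.cong)
    fix s
    have "s div d' = k \<and> s mod d' = c \<longleftrightarrow> s = k * d' + c \<and> c < d'"
      using assms(3) by auto
    then show "delta_A (bit_update d' x s) k c
        = (if s = k * d' + c then (if c < d' then bit_sign x (k * d' + c) else 0) else 0)"
      by (auto simp: bit_update_def)
  qed simp
  moreover have "k * d' + c < n' * d' \<longleftrightarrow> k < n'" if "c < d'"
    by (metis that assms(3) add_eq_if div_less_iff_less_mult div_mult_self3 div_less
      nat_less_le add.commute)
  ultimately show ?thesis using assms by (auto simp: input_A_prefix)
qed

lemma input_b_bit_updates:
  "k < n \<Longrightarrow> input_b n (stream_prefix (bit_update d' x) t) $ k = 0"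
  by (simp add: input_b_prefix bit_update_def)

section \<open>Index queries on asymptotically exact algorithms\<close>

text \<open>The rate \<epsilon> depends on the stream, hence on \<open>x\<close>, which Bob does not
  know. \<open>T\<close> lists the times at which the input has the form of a query; along them each
  \<open>x\<close> is eventually decoded with the required probability.\<close>

lemma index_memory_asymptotic:
  fixes enc :: "'i set \<Rightarrow> entry_update list" and dec :: "'i \<Rightarrow> rvec set"
  assumes exact: "asymptotically_exact \<delta> n d S \<A>"
    and I: "finite I" "I \<noteq> {}" and \<delta>: "0 \<le> \<delta>" "\<delta> < 1 / 2"
    and S: "\<And>x i. x \<subseteq> I \<Longrightarrow> i \<in> I \<Longrightarrow> stream_append (enc x) (\<tau> i) \<in> S"
    and T: "filterlim T at_top sequentially"
    and dec: "\<And>x i. x \<subseteq> I \<Longrightarrow> i \<in> I \<Longrightarrow> \<exists>\<eta>>0. \<forall>\<^sub>F N in sequentially.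
      \<forall>z\<in>reg_approx \<eta> (input_A n d (enc x @ stream_prefix (\<tau> i) (T N)))
        (input_b n (enc x @ stream_prefix (\<tau> i) (T N))). z \<in> dec i \<longleftrightarrow> i \<in> x"
    and P: "\<And>x. x \<subseteq> I \<Longrightarrow> enc x \<in> P"
  shows "ereal ((1 / 2 - \<delta>)\<^sup>2 / 2 * card I) \<le> worst_case_memory \<A> P"
proof -
  define good where "good i x N \<longleftrightarrow> 1 - \<delta> \<le> measure_pmf.prob
    (answer \<A> (enc x @ stream_prefix (\<tau> i) (T N))) (if i \<in> x then dec i else - dec i)" for i x N
  have ev: "\<forall>\<^sub>F N in sequentially. good i x N" if x: "x \<subseteq> I" and i: "i \<in> I" for i x
  proof -
    obtain \<epsilon> where \<epsilon>: "\<epsilon> \<longlonglongrightarrow> 0"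
      and prob: "\<And>t. let us = stream_prefix (stream_append (enc x) (\<tau> i)) t in
        1 - \<delta> \<le> measure_pmf.prob (answer \<A> us) (reg_approx (\<epsilon> t) (input_A n d us) (input_b n us))"
      using exact S[OF x i] unfolding asymptotically_exact_def by blast
    obtain \<eta> where \<eta>: "\<eta> > 0" and ev_dec: "\<forall>\<^sub>F N in sequentially.
      \<forall>z\<in>reg_approx \<eta> (input_A n d (enc x @ stream_prefix (\<tau> i) (T N)))
        (input_b n (enc x @ stream_prefix (\<tau> i) (T N))). z \<in> dec i \<longleftrightarrow> i \<in> x"
      using dec[OF x i] by blast
    have "\<forall>\<^sub>F t in sequentially. \<epsilon> t < \<eta>" using \<epsilon> \<eta> by (rule order_tendstoD)
    moreover have "filterlim (\<lambda>N. length (enc x) + T N) at_top sequentially"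
      by (rule filterlim_at_top_mono[OF T]) simp
    ultimately have "\<forall>\<^sub>F N in sequentially. \<epsilon> (length (enc x) + T N) < \<eta>"
      by (rule eventually_compose_filterlim)
    with ev_dec show ?thesis
    proof eventually_elim
      case (elim N)
      define us where "us = enc x @ stream_prefix (\<tau> i) (T N)"
      define Z where "Z = reg_approx (\<epsilon> (length (enc x) + T N)) (input_A n d us) (input_b n us)"
      have "1 - \<delta> \<le> measure_pmf.prob (answer \<A> us) Z"
        using prob[of "length (enc x) + T N"] by (simp add: stream_prefix_append us_def Z_def Let_def)
      also have "\<dots> \<le> measure_pmf.prob (answer \<A> us) (if i \<in> x then dec i else - dec i)"
      proof (rule measure_pmf.finite_measure_mono)
        have "Z \<subseteq> reg_approx \<eta> (input_A n d us) (input_b n us)"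
          unfolding Z_def using elim by (intro reg_approx_mono) simp
        then show "Z \<subseteq> (if i \<in> x then dec i else - dec i)"
          using elim(1) by (auto simp: us_def)
      qed simp
      finally show ?case by (simp add: good_def us_def)
    qed
  qed
  \<comment> \<open>The finitely many \<open>x\<close> share one \<open>N\<close>, so that Bob's
    suffix depends on \<open>i\<close> alone.\<close>
  have "\<exists>N. \<forall>x\<in>Pow I. good i x N" if "i \<in> I" for i
  proof -
    have "\<forall>\<^sub>F N in sequentially. \<forall>x\<in>Pow I. good i x N"
      using ev that I by (intro eventually_ball_finite) auto
    then show ?thesis by (auto simp: eventually_sequentially)
  qed
  then obtain N where N: "\<And>i x. i \<in> I \<Longrightarrow> x \<subseteq> I \<Longrightarrow> good i x (N i)" by (metis PowI)
  show ?thesis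
    by (rule index_memory[OF I \<delta>, where enc = enc and suf = "\<lambda>i. stream_prefix (\<tau> i) (T (N i))" and dec = dec])
       (use N P in \<open>auto simp: good_def\<close>)
qed

text \<open>One entry carries the whole set \<open>x\<close>. The system is consistent, so an
  acceptable answer has z_0 = 1 / a x exactly, with whatever \<epsilon> holds at that time, and
  \<open>x\<close> is recovered by injectivity.\<close>

lemma exact_index_memory:
  fixes a :: "nat set \<Rightarrow> real"
  assumes exact: "asymptotically_exact \<delta> n d S \<A>" and n: "0 < n" and d: "0 < d" and m: "0 < m"
    and \<delta>: "0 \<le> \<delta>" "\<delta> < 1 / 2"
    and a: "inj_on a (Pow {..<m})" "\<And>x. x \<subseteq> {..<m} \<Longrightarrow> a x \<noteq> 0"
    and S: "\<And>x. x \<subseteq> {..<m} \<Longrightarrow> [Upd_A 0 0 (a x), Upd_b 0 1] \<in> prefixes_of S"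
    and P: "\<And>x. x \<subseteq> {..<m} \<Longrightarrow> [Upd_A 0 0 (a x)] \<in> P"
  shows "ereal ((1 / 2 - \<delta>)\<^sup>2 / 2 * m) \<le> worst_case_memory \<A> P"
proof -
  define dec where "dec i = {z :: rvec. \<exists>x\<subseteq>{..<m}. i \<in> x \<and> a x * z $ 0 = 1}" for i
  have "ereal ((1 / 2 - \<delta>)\<^sup>2 / 2 * card {..<m}) \<le> worst_case_memory \<A> P"
  proof (rule index_memory[where enc = "\<lambda>x. [Upd_A 0 0 (a x)]" and suf = "\<lambda>_. [Upd_b 0 1]" and dec = dec])
    fix x i
    assume x: "x \<subseteq> {..<m}" and i: "i \<in> {..<m}"
    define us where "us = [Upd_A 0 0 (a x), Upd_b 0 1]"
    define A where "A = input_A n d us"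
    define b where "b = input_b n us"
    have Ab: "A \<in> carrier_mat n d" "b \<in> carrier_vec n" by (simp_all add: A_def b_def)
    have res: "residual A b z k = (if k = 0 then a x * z $ 0 - 1 else 0)" if "k < n" for z k
    proof -
      have "(\<Sum>c<d. A $$ (k, c) * z $ c) = (\<Sum>c<d. if c = 0 then (if k = 0 then a x * z $ 0 else 0) else 0)"
        using that by (intro sum.cong) (auto simp: A_def us_def input_A_def)
      then show ?thesis using that d Ab by (auto simp: residual_def b_def us_def input_b_def)
    qed
    obtain \<sigma> t where "\<sigma> \<in> S" "us = stream_prefix \<sigma> t"
      using S[OF x] by (auto simp: prefixes_of_def us_def)
    then obtain \<epsilon> where "1 - \<delta> \<le> measure_pmf.prob (answer \<A> us) (reg_approx \<epsilon> A b)"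
      using exact unfolding asymptotically_exact_def A_def b_def by (metis (no_types, lifting))
    also have "\<dots> \<le> measure_pmf.prob (answer \<A> us) (if i \<in> x then dec i else - dec i)"
    proof (rule measure_pmf.finite_measure_mono)
      have "a x * z $ 0 = 1" if z: "z \<in> reg_approx \<epsilon> A b" for z
      proof -
        have "residual A b z 0 = 0"
        proof (rule reg_approx_consistent[OF Ab _ _ z n])
          show "Matrix.vec d (\<lambda>_. 1 / a x) \<in> carrier_vec d" by simp
          show "residual A b (Matrix.vec d (\<lambda>_. 1 / a x)) k = 0" if "k < n" for k
            using that d a(2)[OF x] by (simp add: res)
        qed
        then show ?thesis using n by (simp add: res)
      qed
      moreover have "i \<in> x" if "a x * z $ 0 = 1" "z \<in> dec i" for z
      proof -
        obtain x' where x': "x' \<subseteq> {..<m}" "i \<in> x'" "a x' * z $ 0 = 1"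
          using \<open>z \<in> dec i\<close> by (auto simp: dec_def)
        have "a x' = a x" using that(1) x'(3) by (metis mult_cancel_right mult_zero_right zero_neq_one)
        then have "x' = x" using a(1) x x'(1) by (auto dest: inj_onD)
        then show ?thesis using x' by simp
      qed
      ultimately show "reg_approx \<epsilon> A b \<subseteq> (if i \<in> x then dec i else - dec i)"
        using x by (auto simp: dec_def)
    qed simp
    finally show "1 - \<delta> \<le> measure_pmf.prob (answer \<A> ([Upd_A 0 0 (a x)] @ [Upd_b 0 1]))
        (if i \<in> x then dec i else - dec i)"
      by (simp add: us_def)
  qed (use \<delta> P m in auto)
  then show ?thesis by simp
qed

text \<open>The natural numbers can name every subset of \<open>n * d\<close> positions; since
  entries are unbounded, one entry yields the bound for any shape of the matrix.\<close>

lemma large_entry_memory: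
  assumes exact: "asymptotically_exact \<delta> n d S \<A>" and n: "0 < n" and d: "0 < d"
    and \<delta>: "0 \<le> \<delta>" "\<delta> < 1 / 2"
    and S: "\<And>a :: nat. [Upd_A 0 0 (real a), Upd_b 0 1] \<in> prefixes_of S"
  shows "ereal ((1 / 2 - \<delta>)\<^sup>2 / 2 * real (n * d)) \<le> worst_case_memory \<A> (prefixes_of S)"
proof -
  obtain f :: "nat set \<Rightarrow> nat" where f: "inj_on f (Pow {..<n * d})"
    by (metis finite_Pow_iff finite_lessThan finite_imp_inj_to_nat_seg)
  show ?thesis
  \<comment> \<open>The successor keeps the entry nonzero.\<close>
  proof (rule exact_index_memory[OF exact n d _ \<delta>, where a = "\<lambda>x. real (Suc (f x))"])
    show "inj_on (\<lambda>x. real (Suc (f x))) (Pow {..<n * d})" using f by (auto simp: inj_on_def)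
    show "[Upd_A 0 0 (real (Suc (f x)))] \<in> prefixes_of S" for x
      by (rule append_in_prefixes_of[where vs = "[Upd_b 0 1]"]) (use S[of "Suc (f x)"] in simp)
  qed (use n d S in \<open>auto simp del: of_nat_Suc\<close>)
qed

section \<open>Unique turnstile updates\<close>

text \<open>After the identity block and the query, zero updates to \<open>b\<close> prolong the
  stream without touching \<open>A\<close>, which keeps the updates of \<open>A\<close>
  unique.\<close>

definition block_tail :: "nat \<Rightarrow> nat \<Rightarrow> real \<Rightarrow> nat \<Rightarrow> stream" where
  "block_tail n' d' N i t =
     (if t < d' then Upd_A (n' + t) t N else if t = d' then Upd_b i 1 else Upd_b 0 0)"

lemma unique_stream_append_b:
  assumes "us = [Upd_A 0 0 a, Upd_b 0 1]" "a \<in> V" "\<int> \<subseteq> V" "0 < n" "0 < d"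
  shows "stream_append us (\<lambda>_. Upd_b 0 0) \<in> unique_turnstile_streams V n d"
proof -
  have "stream_append us (\<lambda>_. Upd_b 0 0) \<in> turnstile_streams V n d"
    using assms by (intro stream_append_turnstile) (auto simp: turnstile_streams_def)
  moreover have "s = 0" if "stream_append us (\<lambda>_. Upd_b 0 0) s = Upd_A i j v" for s i j v
    using that assms(1) by (auto simp: stream_append_def nth_Cons split: if_splits nat.splits)
  ultimately show ?thesis unfolding unique_turnstile_streams_def by blast
qed

lemma unique_stream_append_block:
  assumes dims: "n' + d' \<le> n" "d' \<le> d" and V: "\<int> \<subseteq> V" and N: "N \<in> \<int>" and i: "i < n"
  shows "stream_append (stream_prefix (bit_update d' x) (n' * d')) (block_tail n' d' N i)
           \<in> unique_turnstile_streams V n d" (is "?\<sigma> \<in> _")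
proof -
  have "block_tail n' d' N i \<in> turnstile_streams V n d"
    using assms by (auto simp: turnstile_streams_def block_tail_def)
  then have "?\<sigma> \<in> turnstile_streams V n d"
    using bit_updates_small[of n' n d' d V] dims V by (intro stream_append_turnstile) auto
  \<comment> \<open>The coordinate of an update determines its time: the signs fill rows below
    \<open>n'\<close>, the identity fills later rows, one column after the other.\<close>
  moreover have "s = (if k < n' then k * d' + c else n' * d' + c)" if s: "?\<sigma> s = Upd_A k c v" for s k c v
  proof (cases "s < n' * d'")
    case True
    then have "s div d' = k" "s mod d' = c"
      using s by (auto simp: stream_append_def stream_prefix_def bit_update_def)
    then show ?thesis using div_mod_less(1)[OF True] by (metis div_mult_mod_eq)
  next
    case False
    then show ?thesis using s
      by (auto simp: stream_append_def stream_prefix_def block_tail_def split: if_splits)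
  qed
  ultimately show ?thesis unfolding unique_turnstile_streams_def by blast
qed

lemma input_block_tail:
  assumes "k < n" "t = d' + 1 + r"
  shows "c < d \<Longrightarrow> input_A n d (stream_prefix (block_tail n' d' N i) t) $$ (k, c)
           = (if c < d' \<and> k = n' + c then N else 0)"
    and "input_b n (stream_prefix (block_tail n' d' N i) t) $ k = (if k = i then 1 else 0)"
proof -
  have "(\<Sum>s<t. delta_A (block_tail n' d' N i s) k c)
      = (\<Sum>s<t. if s = c then (if c < d' \<and> k = n' + c then N else 0) else 0)"
    by (intro sum.cong) (auto simp: block_tail_def)
  then show "c < d \<Longrightarrow> input_A n d (stream_prefix (block_tail n' d' N i) t) $$ (k, c)
      = (if c < d' \<and> k = n' + c then N else 0)"
    using assms by (auto simp: input_A_prefix)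
  have "(\<Sum>s<t. delta_b (block_tail n' d' N i s) k)
      = (\<Sum>s<t. if s = d' then (if k = i then 1 else 0) else 0)"
    by (intro sum.cong) (auto simp: block_tail_def)
  then show "input_b n (stream_prefix (block_tail n' d' N i) t) $ k = (if k = i then 1 else 0)"
    using assms by (auto simp: input_b_prefix)
qed

lemma unique_block_memory:
  assumes exact: "asymptotically_exact \<delta> n d (unique_turnstile_streams V n d) \<A>"
    and \<delta>: "0 \<le> \<delta>" "\<delta> < 1 / 2" and V: "\<int> \<subseteq> V"
    and dims: "n' + d' \<le> n" "d' \<le> d" "0 < n'" "0 < d'"
  shows "ereal ((1 / 2 - \<delta>)\<^sup>2 / 2 * real (n' * d')) \<le>
    worst_case_memory \<A> (small_prefixes_of (n * d) (unique_turnstile_streams V n d))"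
proof -
  define N where "N = 8 * real n * real d"
  define \<eta> where "\<eta> = 1 / (200 * (n + N\<^sup>2))"
  have "0 < real n + N\<^sup>2" using dims by (intro add_pos_nonneg) auto
  then have \<eta>: "0 < \<eta>" "200 * (n + N\<^sup>2) * \<eta> \<le> 1" by (simp_all add: \<eta>_def)
  define enc where "enc x = stream_prefix (bit_update d' x) (n' * d')" for x
  define \<tau> where "\<tau> t = block_tail n' d' N (t div d')" for t
  have S: "stream_append (enc x) (\<tau> t) \<in> unique_turnstile_streams V n d" if "t < n' * d'" for x t
    unfolding enc_def \<tau>_def using dims V div_mod_less[OF that]
    by (intro unique_stream_append_block) (auto simp: N_def)
  have "ereal ((1 / 2 - \<delta>)\<^sup>2 / 2 * card {..<n' * d'}) \<le>
    worst_case_memory \<A> (small_prefixes_of (n * d) (unique_turnstile_streams V n d))"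
  proof (rule index_memory_asymptotic[OF exact, where enc = enc and \<tau> = \<tau> and T = "\<lambda>r. d' + 1 + r"
        and dec = "\<lambda>t. {z. 0 < z $ (t mod d')}"])
    fix x t
    assume "t \<in> {..<n' * d'}"
    then have t: "t < n' * d'" by simp
    note ij = div_mod_less[OF t]
    have "z \<in> {z. 0 < z $ (t mod d')} \<longleftrightarrow> t \<in> x"
      if "z \<in> reg_approx \<eta> (input_A n d (enc x @ stream_prefix (\<tau> t) (d' + 1 + r)))
            (input_b n (enc x @ stream_prefix (\<tau> t) (d' + 1 + r)))" for r z
    proof -
      have "0 < bit_sign x (t div d' * d' + t mod d') * z $ (t mod d')"
        by (rule block_query_sign[OF _ _ dims(1,2) ij, where s = "\<lambda>k c. bit_sign x (k * d' + c)"
              and N = N, OF _ _ _ _ _ _ that])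
           (use dims \<eta> in \<open>auto simp: input_A_append input_b_append enc_def \<tau>_def
              input_A_bit_updates input_b_bit_updates input_block_tail N_def\<close>)
      then show ?thesis by (auto simp: bit_sign_def split: if_splits)
    qed
    then show "\<exists>\<eta>>0. \<forall>\<^sub>F r in sequentially.
        \<forall>z\<in>reg_approx \<eta> (input_A n d (enc x @ stream_prefix (\<tau> t) (d' + 1 + r)))
            (input_b n (enc x @ stream_prefix (\<tau> t) (d' + 1 + r))).
          z \<in> {z. 0 < z $ (t mod d')} \<longleftrightarrow> t \<in> x"
      using \<eta>(1) by (intro exI[of _ \<eta>] conjI always_eventually) auto
  next
    show "filterlim (\<lambda>r. d' + 1 + r) at_top sequentially"
      by (rule filterlim_at_top_mono[OF filterlim_ident]) simp
    show "enc x \<in> small_prefixes_of (n * d) (unique_turnstile_streams V n d)" for x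
      unfolding enc_def
      by (rule bit_updates_small_prefix[OF S[of 0 x, unfolded enc_def]]) (use dims in auto)
  qed (use \<delta> S dims in \<open>auto simp: lessThan_empty_iff\<close>)
  then show ?thesis by simp
qed

text \<open>The identity needs \<open>d'\<close> rows of its own, so both dimensions are halved.
  Rounding leaves at least n / 3 rows and d / 2 columns for the signs, which turns 1 / 2 into 1 /
  12. For n = 1 there is no such split, and a single exactly decoded bit is enough.\<close>

lemma unique_small_memory:
  assumes exact: "asymptotically_exact \<delta> n d (unique_turnstile_streams V n d) \<A>"
    and \<delta>: "0 \<le> \<delta>" "\<delta> < 1 / 2" and V: "\<int> \<subseteq> V" and d: "1 \<le> d" "d \<le> n"
  shows "ereal ((1 / 2 - \<delta>)\<^sup>2 / 12 * n * d) \<le>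
    worst_case_memory \<A> (small_prefixes_of (n * d) (unique_turnstile_streams V n d))"
proof (cases "n = 1")
  case False
  define n' where "n' = n div 2"
  define d' where "d' = (d + 1) div 2"
  have n: "2 \<le> n" using False d by simp
  have dims: "n' + d' \<le> n" "d' \<le> d" "0 < n'" "0 < d'"
    using n d by (auto simp: n'_def d'_def)
  have "n \<le> 3 * n'" "d \<le> 2 * d'" using n by (auto simp: n'_def d'_def)
  then have "n * d \<le> 3 * n' * (2 * d')" by (rule mult_le_mono)
  then have "real (n * d) \<le> 6 * real (n' * d')" by (simp flip: of_nat_mult)
  then have "(1 / 2 - \<delta>)\<^sup>2 / 12 * real (n * d) \<le> (1 / 2 - \<delta>)\<^sup>2 / 12 * (6 * real (n' * d'))"
    by (intro mult_left_mono) auto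
  then have "ereal ((1 / 2 - \<delta>)\<^sup>2 / 12 * n * d) \<le> ereal ((1 / 2 - \<delta>)\<^sup>2 / 2 * real (n' * d'))"
    by (simp add: mult_ac)
  also have "\<dots> \<le> worst_case_memory \<A> (small_prefixes_of (n * d) (unique_turnstile_streams V n d))"
    by (rule unique_block_memory[OF exact \<delta> V dims])
  finally show ?thesis .
next
  case True
  with d have [simp]: "n = 1" "d = 1" by auto
  have S: "[Upd_A 0 0 (bit_sign x 0), Upd_b 0 1] \<in> prefixes_of (unique_turnstile_streams V n d)" for x
    by (rule stream_append_in_prefixes_of[OF unique_stream_append_b[OF refl]])
       (use V in \<open>auto simp: bit_sign_def\<close>)
  have "ereal ((1 / 2 - \<delta>)\<^sup>2 / 12 * n * d) \<le> ereal ((1 / 2 - \<delta>)\<^sup>2 / 2 * real 1)"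
    by simp
  also have "\<dots> \<le> worst_case_memory \<A> (small_prefixes_of (n * d) (unique_turnstile_streams V n d))"
  proof (rule exact_index_memory[OF exact _ _ _ \<delta>, where a = "\<lambda>x. bit_sign x 0"])
    show "inj_on (\<lambda>x. bit_sign x 0) (Pow {..<1})"
      by (auto simp: inj_on_def bit_sign_def lessThan_Suc split: if_splits)
    show "[Upd_A 0 0 (bit_sign x 0)] \<in> small_prefixes_of (n * d) (unique_turnstile_streams V n d)" for x
      using append_in_prefixes_of[of "[Upd_A 0 0 (bit_sign x 0)]" "[Upd_b 0 1]"] S[of x]
      by (auto simp: small_prefixes_of_def)
  qed (use S in \<open>auto simp: bit_sign_def\<close>)
  finally show ?thesis .
qed

section \<open>Turnstile updates with diverging smallest singular value\<close>

text \<open>One period adds 1 to each entry \<open>(\<rho> q, q)\<close> with \<open>q < k\<close>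
  and to entry \<open>i\<close> of \<open>b\<close>. After \<open>N\<close> periods all of them have
  grown by exactly \<open>N\<close>, so the query recurs at every scale.\<close>

definition cyclic_tail :: "nat \<Rightarrow> (nat \<Rightarrow> nat) \<Rightarrow> nat \<Rightarrow> stream" where
  "cyclic_tail k \<rho> i t =
     (let q = t mod Suc k in if q = k then Upd_b i 1 else Upd_A (\<rho> q) q 1)"

definition visits :: "nat \<Rightarrow> nat \<Rightarrow> nat \<Rightarrow> real" where
  "visits k q t = (\<Sum>s<t. if s mod Suc k = q then 1 else 0)"

lemma visits_period: "q \<le> k \<Longrightarrow> visits k q (Suc k * N) = N"
proof (induction N)
  case (Suc N)
  have "visits k q (Suc k * Suc N) = visits k q (Suc k * N)
      + (\<Sum>s\<in>{Suc k * N..<Suc k * N + Suc k}. if s mod Suc k = q then 1 else 0)"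
    unfolding visits_def lessThan_atLeast0
    by (subst sum.atLeastLessThan_concat) (auto simp: add.commute)
  also have "(\<Sum>s\<in>{Suc k * N..<Suc k * N + Suc k}. if s mod Suc k = q then 1 else 0 :: real)
      = (\<Sum>s\<in>{0..<Suc k}. if s = q then 1 else 0)"
  proof -
    have "(\<Sum>s\<in>{0 + Suc k * N..<Suc k + Suc k * N}. if s mod Suc k = q then 1 else 0 :: real)
        = (\<Sum>s\<in>{0..<Suc k}. if (s + Suc k * N) mod Suc k = q then 1 else 0)"
      by (rule sum.shift_bounds_nat_ivl)
    also have "\<dots> = (\<Sum>s\<in>{0..<Suc k}. if s = q then 1 else 0)"
      by (intro sum.cong) (auto simp del: mult_Suc)
    finally show ?thesis by (simp add: add.commute)
  qed
  also have "\<dots> = 1" using Suc.prems by simp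
  finally show ?case using Suc by simp
qed (simp add: visits_def)

lemma visits_ge: "q \<le> k \<Longrightarrow> real (t div Suc k) \<le> visits k q t"
proof -
  assume q: "q \<le> k"
  have "visits k q (Suc k * (t div Suc k)) \<le> visits k q t"
    unfolding visits_def by (intro sum_mono2) (auto intro: less_le_trans[OF _ times_div_less_eq_dividend] simp del: mult_Suc)
  then show ?thesis by (simp only: visits_period[OF q])
qed

lemma input_cyclic_tail:
  assumes "r < n"
  shows "c < d \<Longrightarrow> input_A n d (stream_prefix (cyclic_tail k \<rho> i) t) $$ (r, c)
           = (if c < k \<and> r = \<rho> c then visits k c t else 0)"
    and "input_b n (stream_prefix (cyclic_tail k \<rho> i) t) $ r = (if r = i then visits k k t else 0)"
proof -
  have "(\<Sum>s<t. delta_A (cyclic_tail k \<rho> i s) r c)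
      = (\<Sum>s<t. if c < k \<and> r = \<rho> c then (if s mod Suc k = c then 1 else 0) else 0)"
  proof (rule sum.cong)
    fix s
    have "s mod Suc k \<le> k" using mod_less_divisor[of "Suc k" s] by simp
    then show "delta_A (cyclic_tail k \<rho> i s) r c
        = (if c < k \<and> r = \<rho> c then (if s mod Suc k = c then 1 else 0) else 0)"
      by (auto simp: cyclic_tail_def Let_def order_less_le)
  qed simp
  then show "c < d \<Longrightarrow> input_A n d (stream_prefix (cyclic_tail k \<rho> i) t) $$ (r, c)
      = (if c < k \<and> r = \<rho> c then visits k c t else 0)"
    using assms by (auto simp: input_A_prefix visits_def)
  have "(\<Sum>s<t. delta_b (cyclic_tail k \<rho> i s) r)
      = (\<Sum>s<t. if r = i then (if s mod Suc k = k then 1 else 0) else 0)"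
    by (intro sum.cong) (auto simp: cyclic_tail_def Let_def)
  then show "input_b n (stream_prefix (cyclic_tail k \<rho> i) t) $ r = (if r = i then visits k k t else 0)"
    using assms by (auto simp: input_b_prefix visits_def)
qed

text \<open>The entries written by \<open>us\<close> are bounded by a constant \<open>C\<close>,
  while the entries \<open>(\<rho> c, c)\<close> grow without bound. They come to dominate their
  rows, or their columns if n < d, where the Gram matrix of the transpose counts.\<close>

lemma diverging_stream_append:
  assumes us: "\<And>u. u \<in> set us \<Longrightarrow> upd_in_range n d u \<and> upd_value u \<in> V"
    and V: "\<int> \<subseteq> V" and n: "0 < n" and d: "0 < d" and k: "k = min n d" and i: "i < n"
    and \<rho>: "inj_on \<rho> {..<k}" "\<And>c. c < k \<Longrightarrow> \<rho> c < n" "\<And>c. n < d \<Longrightarrow> \<rho> c = c"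
  shows "stream_append us (cyclic_tail k \<rho> i) \<in> diverging_turnstile_streams V n d"
    (is "?\<sigma> \<in> _")
proof -
  have k0: "0 < k" using n d k by simp
  have "cyclic_tail k \<rho> i \<in> turnstile_streams V n d"
  proof -
    have "upd_in_range n d (cyclic_tail k \<rho> i t) \<and> upd_value (cyclic_tail k \<rho> i t) \<in> V" for t
    proof -
      have "t mod Suc k \<le> k" using mod_less_divisor[of "Suc k" t] by simp
      then have "t mod Suc k = k \<or> t mod Suc k < d \<and> \<rho> (t mod Suc k) < n"
        using \<rho>(2)[of "t mod Suc k"] k by linarith
      then show ?thesis using i V by (auto simp: cyclic_tail_def Let_def)
    qed
    then show ?thesis by (simp add: turnstile_streams_def)
  qed
  then have "?\<sigma> \<in> turnstile_streams V n d" using us by (intro stream_append_turnstile) auto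
  moreover have "filterlim (\<lambda>t. smallest_singular_value (input_A n d (stream_prefix ?\<sigma> t)))
      at_top sequentially"
  proof -
    define B where "B = input_A n d us"
    define C where "C = (\<Sum>r<n. \<Sum>c<d. \<bar>B $$ (r, c)\<bar>)"
    have C0: "0 \<le> C" by (simp add: C_def sum_nonneg)
    have B: "\<bar>B $$ (r, c)\<bar> \<le> C" if "r < n" "c < d" for r c
    proof -
      have "\<bar>B $$ (r, c)\<bar> \<le> (\<Sum>c<d. \<bar>B $$ (r, c)\<bar>)" using that by (intro member_le_sum) auto
      also have "\<dots> \<le> C" unfolding C_def using that
        by (intro member_le_sum[where f = "\<lambda>r. \<Sum>c<d. \<bar>B $$ (r, c)\<bar>"]) (auto intro: sum_nonneg)
      finally show ?thesis .
    qed
    have bound: "(real (t div Suc k) - C - C * k) / k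
          \<le> smallest_singular_value (input_A n d (stream_prefix ?\<sigma> (length us + t)))"
      if t: "C + C * k \<le> real (t div Suc k)" for t
    proof -
      define w where "w = real (t div Suc k) - C"
      define A where "A = input_A n d (us @ stream_prefix (cyclic_tail k \<rho> i) t)"
      define M where "M = (if d \<le> n then A else transpose_mat A)"
      have A: "A \<in> carrier_mat n d" by (simp add: A_def)
      have A_entry: "A $$ (r, c) = B $$ (r, c) + (if c < k \<and> r = \<rho> c then visits k c t else 0)"
        if "r < n" "c < d" for r c
        using that by (simp add: A_def B_def input_A_append input_cyclic_tail)
      have diag: "w \<le> A $$ (\<rho> c, c)" if c: "c < k" for c
        using B[of "\<rho> c" c] visits_ge[of c k t] \<rho>(2)[OF c] c k by (simp add: A_entry w_def)
      \<comment> \<open>\<open>f c\<close> is the row of \<open>M\<close> dominated by column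
        \<open>c\<close>: row \<open>\<rho> c\<close> of \<open>A\<close> if
        \<open>d \<le> n\<close>. Otherwise the rows of \<open>M\<close> are columns of
        \<open>A\<close>, and \<rho> is the identity.\<close>
      have "\<exists>f. (\<forall>c<k. f c < max n d \<and> w \<le> M $$ (f c, c)) \<and>
          (\<forall>c c'. c < k \<longrightarrow> c' < k \<longrightarrow> c' \<noteq> c \<longrightarrow> \<bar>M $$ (f c, c')\<bar> \<le> C)"
      proof (cases "d \<le> n")
        case True
        then have kd: "k = d" using k by simp
        have "\<bar>A $$ (\<rho> c, c')\<bar> \<le> C" if "c < k" "c' < k" "c' \<noteq> c" for c c'
        proof -
          have "\<rho> c \<noteq> \<rho> c'" using \<rho>(1) that by (auto dest: inj_onD)
          then show ?thesis using B[of "\<rho> c" c'] \<rho>(2)[OF that(1)] that kd by (simp add: A_entry)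
        qed
        then show ?thesis using True diag \<rho>(2) by (intro exI[of _ \<rho>]) (auto simp: M_def)
      next
        case False
        then have kn: "k = n" and id: "\<And>c. \<rho> c = c" using k \<rho>(3) by auto
        have "\<bar>A $$ (c', c)\<bar> \<le> C" if "c < k" "c' < k" "c' \<noteq> c" for c c'
          using B[of c' c] that kn id False by (simp add: A_entry)
        then show ?thesis using False diag A kn id by (intro exI[of _ id]) (auto simp: M_def)
      qed
      then obtain f where f: "\<And>c. c < k \<Longrightarrow> f c < max n d" "\<And>c. c < k \<Longrightarrow> w \<le> M $$ (f c, c)"
        "\<And>c c'. c < k \<Longrightarrow> c' < k \<Longrightarrow> c' \<noteq> c \<Longrightarrow> \<bar>M $$ (f c, c')\<bar> \<le> C"
        by blast
      have M: "M \<in> carrier_mat (max n d) k" using A k by (auto simp: M_def max_def min_def)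
      have "(w - C * k) / k \<le> smallest_singular_value A"
      proof (rule smallest_singular_value_ge[OF A n d M_def])
        show "0 \<le> (w - C * k) / k" using t by (simp add: w_def)
        show "((w - C * k) / k)\<^sup>2 * scalar_prod v v \<le> scalar_prod (M *\<^sub>v v) (M *\<^sub>v v)"
          if "v \<in> carrier_vec (min n d)" for v
          by (rule dominant_rows_gram_ge[OF M k0 f C0]) (use t that k in \<open>auto simp: w_def\<close>)
      qed
      then show ?thesis by (simp add: A_def w_def stream_prefix_append)
    qed
    show ?thesis
      unfolding filterlim_at_top
    proof
      fix Z :: real
      \<comment> \<open>After \<open>L\<close> periods the lower bound in \<open>bound\<close>
        reaches \<open>Z\<close>; the maximum with 0 secures its premise.\<close>
      define L where "L = nat \<lceil>C + C * k + k * max Z 0\<rceil>"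
      have L: "C + C * k + k * max Z 0 \<le> real L" unfolding L_def by (rule real_nat_ceiling_ge)
      have "Z \<le> smallest_singular_value (input_A n d (stream_prefix ?\<sigma> t))"
        if "length us + Suc k * L \<le> t" for t
      proof -
        obtain t' where t': "t = length us + t'" "Suc k * L \<le> t'"
          using \<open>length us + Suc k * L \<le> t\<close> by (metis add_le_imp_le_left le_add1 le_trans nat_le_iff_add)
        have "L \<le> t' div Suc k"
          using div_le_mono[OF t'(2), of "Suc k"] by (simp del: mult_Suc)
        with L have ge: "C + C * k + k * max Z 0 \<le> real (t' div Suc k)"
          by (meson of_nat_mono order_trans)
        moreover have "0 \<le> k * max Z 0" by simp
        ultimately have "C + C * k \<le> real (t' div Suc k)" by linarith
        from bound[OF this] have "(real (t' div Suc k) - C - C * k) / k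
            \<le> smallest_singular_value (input_A n d (stream_prefix ?\<sigma> t))"
          by (simp add: t')
        moreover have "max Z 0 \<le> (real (t' div Suc k) - C - C * k) / k"
          using ge k0 by (simp add: le_divide_eq mult.commute)
        ultimately show ?thesis by linarith
      qed
      then show "\<forall>\<^sub>F t in sequentially. Z \<le> smallest_singular_value (input_A n d (stream_prefix ?\<sigma> t))"
        unfolding eventually_sequentially by blast
    qed
  qed
  ultimately show ?thesis by (simp add: diverging_turnstile_streams_def)
qed

text \<open>The growing entries overlay the signs instead of occupying further rows, so all
  \<open>n * d\<close> entries carry a bit.\<close>

lemma diverging_small_memory:
  assumes exact: "asymptotically_exact \<delta> n d (diverging_turnstile_streams V n d) \<A>"
    and \<delta>: "0 \<le> \<delta>" "\<delta> < 1 / 2" and V: "\<int> \<subseteq> V" and d: "1 \<le> d" "d \<le> n"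
  shows "ereal ((1 / 2 - \<delta>)\<^sup>2 / 2 * real (n * d)) \<le>
    worst_case_memory \<A> (small_prefixes_of (n * d) (diverging_turnstile_streams V n d))"
proof -
  define \<eta> where "\<eta> = 1 / (3072 * real n ^ 3)"
  have \<eta>: "0 < \<eta>" "3072 * real n ^ 3 * \<eta> \<le> 1" using d by (simp_all add: \<eta>_def)
  define enc where "enc x = stream_prefix (bit_update d x) (n * d)" for x
  \<comment> \<open>The transposition of \<open>t mod d\<close> and \<open>t div d\<close>: it is
    injective and sends the queried column \<open>t mod d\<close> to the queried row
    \<open>t div d\<close>. Values stay below \<open>n\<close> because
    \<open>d \<le> n\<close>.\<close>
  define \<pi> where "\<pi> t c = (if c = t mod d then t div d else if c = t div d then t mod d else c)" for t c
  define \<tau> where "\<tau> t = cyclic_tail d (\<pi> t) (t div d)" for t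
  have \<pi>: "inj_on (\<pi> t) {..<d}" "\<And>c. c < d \<Longrightarrow> \<pi> t c < n" if "t < n * d" for t
    using div_mod_less[OF that] less_le_trans[OF div_mod_less(2)[OF that] d(2)] d
    by (auto simp: \<pi>_def inj_on_def split: if_splits)
  have S: "stream_append (enc x) (\<tau> t) \<in> diverging_turnstile_streams V n d" if "t < n * d" for x t
    unfolding enc_def \<tau>_def using bit_updates_small[of n n d d V] V d \<pi>[OF that] div_mod_less[OF that]
    by (intro diverging_stream_append) auto
  have "ereal ((1 / 2 - \<delta>)\<^sup>2 / 2 * card {..<n * d}) \<le>
    worst_case_memory \<A> (small_prefixes_of (n * d) (diverging_turnstile_streams V n d))"
  \<comment> \<open>Queries fall on the ends of periods, where every chosen entry has grown by
    exactly \<open>N\<close>. The coordinate of the solution is below 1 if and only if the sign is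
    positive.\<close>
  proof (rule index_memory_asymptotic[OF exact, where enc = enc and \<tau> = \<tau> and T = "\<lambda>N. Suc d * N"
        and dec = "\<lambda>t. {z. z $ (t mod d) < 1}"])
    fix x t
    assume "t \<in> {..<n * d}"
    then have t: "t < n * d" by simp
    note ij = div_mod_less[OF t]
    have \<pi>_ij: "\<pi> t (t mod d) = t div d" by (simp add: \<pi>_def)
    have "z \<in> {z. z $ (t mod d) < 1} \<longleftrightarrow> t \<in> x"
      if z: "z \<in> reg_approx \<eta> (input_A n d (enc x @ stream_prefix (\<tau> t) (Suc d * N)))
            (input_b n (enc x @ stream_prefix (\<tau> t) (Suc d * N)))"
        and N: "16 * real n ^ 2 + 13 * real n * real d \<le> real N" for N z
    proof -
      have "0 < bit_sign x (\<pi> t (t mod d) * d + t mod d) * (1 - z $ (t mod d))"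
        by (rule permutation_query_sign[OF _ _ \<pi>[OF t] ij(2), where s = "\<lambda>k c. bit_sign x (k * d + c)"
              and N = N, OF _ _ _ _ _ _ N z])
           (use d \<eta> in \<open>auto simp: input_A_append input_b_append enc_def \<tau>_def \<pi>_ij visits_period
              input_A_bit_updates input_b_bit_updates input_cyclic_tail simp del: mult_Suc\<close>)
      then show ?thesis by (auto simp: \<pi>_ij bit_sign_def split: if_splits)
    qed
    moreover have "\<forall>\<^sub>F N in sequentially. 16 * real n ^ 2 + 13 * real n * real d \<le> real N"
      using filterlim_real_sequentially unfolding filterlim_at_top by blast
    ultimately show "\<exists>\<eta>>0. \<forall>\<^sub>F N in sequentially.
        \<forall>z\<in>reg_approx \<eta> (input_A n d (enc x @ stream_prefix (\<tau> t) (Suc d * N)))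
            (input_b n (enc x @ stream_prefix (\<tau> t) (Suc d * N))).
          z \<in> {z. z $ (t mod d) < 1} \<longleftrightarrow> t \<in> x"
      using \<eta>(1) by (intro exI[of _ \<eta>] conjI) (auto elim!: eventually_mono)
  next
    show "filterlim (\<lambda>N. Suc d * N) at_top sequentially"
      by (rule filterlim_at_top_mono[OF filterlim_ident]) simp
    show "enc x \<in> small_prefixes_of (n * d) (diverging_turnstile_streams V n d)" for x
      unfolding enc_def
      by (rule bit_updates_small_prefix[OF S[of 0 x, unfolded enc_def]]) (use d in auto)
  qed (use \<delta> S d in \<open>auto simp: lessThan_empty_iff\<close>)
  then show ?thesis by simp
qed

section \<open>Transfer between the models and assembly of the bounds\<close>

lemma needs_Omega_nd_memory_mono:
  assumes "\<And>V n d. \<S>' V n d \<subseteq> \<S> V n d" and "needs_Omega_nd_memory \<delta> \<S>'"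
  shows "needs_Omega_nd_memory \<delta> \<S>"
proof -
  have exact: "asymptotically_exact \<delta> n d (\<S>' V n d) \<A>"
    if "asymptotically_exact \<delta> n d (\<S> V n d) \<A>" for V n d \<A>
    using that assms(1) unfolding asymptotically_exact_def by blast
  have mono: "worst_case_memory \<A> P \<le> worst_case_memory \<A> Q" if "P \<subseteq> Q" for \<A> P Q
    unfolding worst_case_memory_def using that by (rule SUP_subset_mono) simp
  have prefixes: "prefixes_of (\<S>' V n d) \<subseteq> prefixes_of (\<S> V n d)" for V n d
    using assms(1) unfolding prefixes_of_def by blast
  then have "small_prefixes_of T (\<S>' V n d) \<subseteq> small_prefixes_of T (\<S> V n d)" for T V n d
    by (auto simp: small_prefixes_of_def)
  then show ?thesis
    using assms(2) exact mono prefixes unfolding needs_Omega_nd_memory_def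
    by (meson order_trans)
qed

text \<open>The constant is the smaller of two: the factor 1 / 2 comes from one large entry, the
  factor 1 / 12 from the small prefixes.\<close>

lemma needs_Omega_nd_memoryI:
  assumes \<delta>: "0 \<le> \<delta>" "\<delta> < 1 / 2"
    and large: "\<And>V n d a. \<int> \<subseteq> V \<Longrightarrow> 0 < n \<Longrightarrow> 0 < d \<Longrightarrow>
      [Upd_A 0 0 (real a), Upd_b 0 1] \<in> prefixes_of (\<S> V n d)"
    and small: "\<And>V n d \<A>. asymptotically_exact \<delta> n d (\<S> V n d) \<A> \<Longrightarrow> \<int> \<subseteq> V \<Longrightarrow> 1 \<le> d \<Longrightarrow> d \<le> n \<Longrightarrow>
      ereal ((1 / 2 - \<delta>)\<^sup>2 / 12 * n * d) \<le> worst_case_memory \<A> (small_prefixes_of (n * d) (\<S> V n d))"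
  shows "needs_Omega_nd_memory \<delta> \<S>"
  unfolding needs_Omega_nd_memory_def
proof (intro exI[of _ "(1 / 2 - \<delta>)\<^sup>2 / 12"] conjI allI impI; (elim conjE)?)
  show "0 < (1 / 2 - \<delta>)\<^sup>2 / 12" using \<delta> by simp
  fix V n d \<A>
  assume V: "\<int> \<subseteq> V" and nd: "1 \<le> n" "1 \<le> d" and exact: "asymptotically_exact \<delta> n d (\<S> V n d) \<A>"
  have "(1 / 2 - \<delta>)\<^sup>2 / 12 * (real n * real d) \<le> (1 / 2 - \<delta>)\<^sup>2 / 2 * (real n * real d)"
    by (intro mult_right_mono) auto
  then have "ereal ((1 / 2 - \<delta>)\<^sup>2 / 12 * n * d) \<le> ereal ((1 / 2 - \<delta>)\<^sup>2 / 2 * real (n * d))"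
    by (simp add: mult.assoc)
  also have "\<dots> \<le> worst_case_memory \<A> (prefixes_of (\<S> V n d))"
    using V nd by (intro large_entry_memory[OF exact] \<delta> large) auto
  finally show "ereal ((1 / 2 - \<delta>)\<^sup>2 / 12 * n * d) \<le> worst_case_memory \<A> (prefixes_of (\<S> V n d))" .
  show "ereal ((1 / 2 - \<delta>)\<^sup>2 / 12 * n * d) \<le> worst_case_memory \<A> (small_prefixes_of (n * d) (\<S> V n d))"
    if "d \<le> n"
    using exact V nd(2) that by (rule small)
qed

theorem theorem14:
  fixes \<delta> :: real
  assumes "0 \<le> \<delta>" and "\<delta> < 1 / 2"
  shows "needs_Omega_nd_memory \<delta> turnstile_streams
       \<and> needs_Omega_nd_memory \<delta> unique_turnstile_streams
       \<and> needs_Omega_nd_memory \<delta> diverging_turnstile_streams"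
proof (intro conjI)
  show unique: "needs_Omega_nd_memory \<delta> unique_turnstile_streams"
  proof (rule needs_Omega_nd_memoryI[OF assms])
    fix V :: "real set" and n d a :: nat
    assume "\<int> \<subseteq> V" "0 < n" "0 < d"
    then show "[Upd_A 0 0 (real a), Upd_b 0 1] \<in> prefixes_of (unique_turnstile_streams V n d)"
      by (intro stream_append_in_prefixes_of[OF unique_stream_append_b[OF refl]]) auto
  qed (rule unique_small_memory[OF _ assms])
  \<comment> \<open>An algorithm exact on all turnstile streams is exact on the unique ones, and its
    memory is a supremum over more prefixes.\<close>
  then show "needs_Omega_nd_memory \<delta> turnstile_streams"
    by (rule needs_Omega_nd_memory_mono[rotated]) (auto simp: unique_turnstile_streams_def)
  show "needs_Omega_nd_memory \<delta> diverging_turnstile_streams"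
  proof (rule needs_Omega_nd_memoryI[OF assms])
    fix V :: "real set" and n d a :: nat
    assume "\<int> \<subseteq> V" "0 < n" "0 < d"
    then show "[Upd_A 0 0 (real a), Upd_b 0 1] \<in> prefixes_of (diverging_turnstile_streams V n d)"
      by (intro stream_append_in_prefixes_of[OF diverging_stream_append[where k = "min n d" and \<rho> = "\<lambda>c. c" and i = 0]])
         auto
  next
    fix V :: "real set" and n d :: nat and \<A>
    assume exact: "asymptotically_exact \<delta> n d (diverging_turnstile_streams V n d) \<A>"
      and V: "\<int> \<subseteq> V" and d: "1 \<le> d" "d \<le> n"
    have "(1 / 2 - \<delta>)\<^sup>2 / 12 * (real n * real d) \<le> (1 / 2 - \<delta>)\<^sup>2 / 2 * (real n * real d)"
      by (intro mult_right_mono) auto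
    then have "ereal ((1 / 2 - \<delta>)\<^sup>2 / 12 * n * d) \<le> ereal ((1 / 2 - \<delta>)\<^sup>2 / 2 * real (n * d))"
      by (simp add: mult.assoc)
    also note diverging_small_memory[OF exact assms V d]
    finally show "ereal ((1 / 2 - \<delta>)\<^sup>2 / 12 * n * d) \<le>
        worst_case_memory \<A> (small_prefixes_of (n * d) (diverging_turnstile_streams V n d))" .
  qed
qed

end
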